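(* There is a constant $c>1$ such that the following holds. For any $k,n\in\mathbb{N}$ with $n\ge ck$ and any alphabet $\Sigma$, any $R$-pass randomized algorithm in the asymmetric streaming model that, given two strings $x,y\in\Sigma^n$, decides whether $\mathsf{LCS}(x,y)\ge k$ with success probability at least $2/3$ must use space $\Omega(\min(k,|\Sigma|)/R)$. Moreover, this lower bound holds even when $x$ is restricted to be a permutation of $y$, in the cases $|\Sigma|\ge n$ or $|\Sigma|\le k$.
   Context: $\mathsf{LCS}(x,y)$ is the length of a longest common subsequence of $x$ and $y$ (a longest string that is a subsequence of both). In the asymmetric streaming model, the algorithm has streaming access to $x$ (reading it left to right, once per pass; $R$ passes in total) and random access to $y$; space is the working memory of the algorithm.
   Formalization: For permutations with |Σ| ≤ k, the condition n ≤ (k−1)|Σ| is added: otherwise some symbol occurs at least k times in both strings, LCS(x,y) ≥ k always and no space is needed. Ω is read as holding once min(k,|Σ|) exceeds an absolute constant; Σ is finite. *)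

theory Defs
  imports "HOL-Probability.Probability" "HOL-Library.Sublist" "HOL-Library.Multiset"
begin

definition lcs :: "'a list \<Rightarrow> 'a list \<Rightarrow> nat" where
  "lcs x y = Max {length z |z. subseq z x \<and> subseq z y}"

text \<open>
  A deterministic algorithm in the asymmetric streaming model. The working memory is a bit string.
  \<open>step y r i m a\<close> is the new memory content after reading the symbol \<open>a\<close> at position \<open>i\<close> of the
  stream during pass \<open>r\<close> with memory content \<open>m\<close>. Random access to the second string is rendered
  by letting \<open>step\<close> and \<open>out\<close> depend on \<open>y\<close>: whatever is computed between two reads of the stream
  is a function of \<open>y\<close> and of the working memory. The time \<open>(r, i)\<close> and the computation between two
  reads are not charged, so every algorithm with \<open>s\<close> bits of working memory is covered.
\<close>

record 'a stream_alg =
  init :: "bool list"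
  step :: "'a list \<Rightarrow> nat \<Rightarrow> nat \<Rightarrow> bool list \<Rightarrow> 'a \<Rightarrow> bool list"
  out :: "'a list \<Rightarrow> bool list \<Rightarrow> bool"

fun run_pass :: "'a stream_alg \<Rightarrow> 'a list \<Rightarrow> nat \<Rightarrow> nat \<Rightarrow> bool list \<Rightarrow> 'a list \<Rightarrow> bool list" where
  "run_pass A y r i m [] = m"
| "run_pass A y r i m (a # x) = run_pass A y r (Suc i) (step A y r i m a) x"

definition run :: "'a stream_alg \<Rightarrow> nat \<Rightarrow> 'a list \<Rightarrow> 'a list \<Rightarrow> bool" where
  "run A R x y = out A y (fold (\<lambda>r m. run_pass A y r 0 m x) [0..<R] (init A))"

text \<open>
  A randomized algorithm is a probability distribution over deterministic ones, i.e. the random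
  string is fixed in advance, may be reread, and is not charged as space. As the transitions depend
  on the time, this subsumes algorithms that toss fresh coins at every step.
\<close>

definition uses_space :: "nat \<Rightarrow> 'a stream_alg pmf \<Rightarrow> bool" where
  "uses_space s D \<longleftrightarrow> (\<forall>A\<in>set_pmf D. length (init A) = s \<and>
     (\<forall>y r i m a. length m = s \<longrightarrow> length (step A y r i m a) = s))"

definition decides_lcs_ge ::
    "nat \<Rightarrow> nat \<Rightarrow> ('a list \<times> 'a list) set \<Rightarrow> 'a stream_alg pmf \<Rightarrow> bool" where
  "decides_lcs_ge R k I D \<longleftrightarrow>
     (\<forall>(x, y)\<in>I. measure_pmf.prob D {A. run A R x y \<longleftrightarrow> lcs x y \<ge> k} \<ge> 2 / 3)"

definition string_pairs :: "'a set \<Rightarrow> nat \<Rightarrow> ('a list \<times> 'a list) set" where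
  "string_pairs \<Sigma> n = {(x, y). x \<in> lists \<Sigma> \<and> y \<in> lists \<Sigma> \<and> length x = n \<and> length y = n}"

definition perm_pairs :: "'a set \<Rightarrow> nat \<Rightarrow> ('a list \<times> 'a list) set" where
  "perm_pairs \<Sigma> n = {(x, y) \<in> string_pairs \<Sigma> n. mset x = mset y}"

lemma subseq_replicate_count: "subseq (replicate (count (mset x) a) a) x"
proof (induction x)
  case (Cons b x)
  then show ?case by (cases "a = b") auto
qed simp

lemma length_le_lcs:
  assumes "subseq z x" "subseq z y"
  shows "length z \<le> lcs x y"
proof -
  have "{length z |z. subseq z x \<and> subseq z y} \<subseteq> {..length x}"
    by (auto dest: list_emb_length)
  then have "finite {length z |z. subseq z x \<and> subseq z y}"
    using finite_subset by blast
  then show ?thesis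
    unfolding lcs_def using assms by (intro Max_ge) auto
qed

text \<open>
  For \<open>n > (k - 1) * card \<Sigma>\<close> some symbol occurs at least \<open>k\<close> times, hence in both strings if one
  is a permutation of the other; the problem restricted to permutations is then solved without any
  memory. A lower bound for the restricted problem therefore needs \<open>n \<le> (k - 1) * card \<Sigma>\<close>.
\<close>

lemma lcs_ge_perm_pairs:
  assumes "finite \<Sigma>" "(k - 1) * card \<Sigma> < n" "(x, y) \<in> perm_pairs \<Sigma> n"
  shows "k \<le> lcs x y"
proof -
  have x: "set x \<subseteq> \<Sigma>" "length x = n" and xy: "mset x = mset y"
    using assms(3) by (auto simp: perm_pairs_def string_pairs_def)
  have "\<exists>a\<in>\<Sigma>. k \<le> count (mset x) a"
  proof (rule ccontr)
    assume "\<not> ?thesis"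
    then have "count (mset x) a \<le> k - 1" if "a \<in> \<Sigma>" for a
      using that by force
    then have "(\<Sum>a\<in>\<Sigma>. count (mset x) a) \<le> (k - 1) * card \<Sigma>"
      using sum_bounded_above[of \<Sigma> "count (mset x)" "k - 1"] by (simp add: mult.commute)
    moreover have "(\<Sum>a\<in>\<Sigma>. count (mset x) a) = n"
      using x assms(1) by (simp add: sum_count_set count_mset)
    ultimately show False using assms(2) by simp
  qed
  then obtain a where a: "k \<le> count (mset x) a" by blast
  have "count (mset x) a \<le> lcs x y"
    using length_le_lcs[OF subseq_replicate_count[of x a]] subseq_replicate_count[of y a] xy
    by simp
  then show ?thesis using a by simp
qed

lemma decides_without_memory:
  assumes "finite \<Sigma>" "(k - 1) * card \<Sigma> < n"
  shows "\<exists>D. uses_space 0 D \<and> decides_lcs_ge R k (perm_pairs \<Sigma> n) D"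
proof -
  let ?A = "\<lparr>init = [], step = \<lambda>_ _ _ _ _. [], out = \<lambda>_ _. True\<rparr>"
  have "uses_space 0 (return_pmf ?A)"
    by (simp add: uses_space_def)
  moreover have "decides_lcs_ge R k (perm_pairs \<Sigma> n) (return_pmf ?A)"
    using lcs_ge_perm_pairs[OF assms]
    by (auto simp: decides_lcs_ge_def run_def measure_return_pmf)
  ultimately show ?thesis by blast
qed

end

theory Submission
  imports Defs
begin

text \<open>
  Set disjointness on \<open>t = \<Omega>(min k |\<Sigma>|)\<close> bits is embedded into the problem with a fixed string \<open>y\<close>: the
  stream is \<open>p a @ q b @ p' a\<close>, and its longest common subsequence with \<open>y\<close> reaches \<open>k\<close> iff
  \<open>a \<inter> b \<noteq> {}\<close>. An algorithm with \<open>s\<close> bits and \<open>R\<close> passes then partitions the inputs into at most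
  \<open>2 ^ (3 * R * s)\<close> rectangles.

  Disjointness needs linearly many bits. Fix which of the two players may own each index and let the
  owners choose at random. By the level-1 inequality (a class of density \<open>d\<close> in the cube has squared
  biases summing to at most \<open>2 * ln (1 / d)\<close>), for a typical index \<open>i\<close> the transcript hardly depends,
  in Hellinger distance, on whether the owner adds \<open>i\<close>. The rectangle property lets one
  exchange the pairs of inputs (00, 11) and (01, 10) in the Hellinger affinity, so a transcript cannot
  tell apart disjoint sets from sets that meet only in \<open>i\<close>.

  Two embeddings are used. For small \<open>n\<close>, \<open>y\<close> is increasing without repetition, and an increasing
  subsequence of the stream switches from the first to the second player at some index, gaining an
  additional element iff both own it. When \<open>n\<close> is close to its maximal value \<open>(k - 1) * |\<Sigma>|\<close>, every symbol
  has to occur \<open>k - 1\<close> times; with \<open>y\<close> sorted, the value \<open>k\<close> is then reached iff some prefix of the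
  stream contains a smaller symbol more often than a larger one. Intermediate lengths are obtained
  from fillers that precede the instance in one string and follow it, reversed, in the other.
\<close>

section \<open>The level-1 inequality\<close>

text \<open>For nonnegative \<open>x\<close> this is the logarithmic estimate behind Hoeffding's
  lemma for a fair sign; both sides are even in \<open>x\<close>.\<close>

lemma cosh_le_exp_half_square: "cosh x \<le> exp (x\<^sup>2 / 2)" for x :: real
proof -
  have *: "cosh x \<le> exp (x\<^sup>2 / 2)" if "x \<ge> 0" for x :: real
  proof -
    have "- x + ln ((1 + exp (2 * x)) / 2) \<le> x\<^sup>2 / 2"
      using Hoeffdings_lemma_aux[of "2 * x" "1 / 2"] that
      by (simp add: power_mult_distrib field_simps)
    then have le: "exp (- x + ln ((1 + exp (2 * x)) / 2)) \<le> exp (x\<^sup>2 / 2)"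
      by simp
    have "cosh x = exp (- x) * ((1 + exp (2 * x)) / 2)"
      by (simp add: cosh_def field_simps flip: exp_add)
    also have "\<dots> = exp (- x + ln ((1 + exp (2 * x)) / 2))"
      by (subst exp_add) (simp add: add_pos_pos)
    finally show ?thesis using le by linarith
  qed
  show ?thesis
    using *[of x] *[of "- x"] by (cases "x \<ge> 0") auto
qed

definition bit_sign :: "'a \<Rightarrow> 'a set \<Rightarrow> real" where
  "bit_sign i W = (if i \<in> W then 1 else - 1)"

text \<open>The linear form \<open>l\<close>, whose coefficients are the mean signs
  \<open>b i\<close> over \<open>S\<close>, has mean \<open>M\<close> on \<open>S\<close>. By
  convexity its exponential sum over \<open>S\<close> is at least \<open>card S * exp M\<close>,
  whereas over the whole cube it factors and is at most
  \<open>2 ^ card V * exp (M / 2)\<close>.\<close>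

lemma level_one_inequality:
  fixes V :: "'a set" and S :: "'a set set"
  assumes V: "finite V" and S: "S \<subseteq> Pow V" "S \<noteq> {}"
  shows "(\<Sum>i\<in>V. (\<Sum>W\<in>S. bit_sign i W)\<^sup>2) \<le> 2 * (real (card S))\<^sup>2 * ln (2 ^ card V / real (card S))"
proof -
  have fin: "finite S" using V S finite_subset by blast
  then have N: "real (card S) > 0" using S by (simp add: card_gt_0_iff)
  define b where "b i = (\<Sum>W\<in>S. bit_sign i W) / card S" for i
  define M where "M = (\<Sum>i\<in>V. (b i)\<^sup>2)"
  define l where "l W = (\<Sum>i\<in>V. b i * bit_sign i W)" for W
  have l_sum: "(\<Sum>W\<in>S. l W) = card S * M"
  proof -
    have "(\<Sum>W\<in>S. l W) = (\<Sum>i\<in>V. b i * (\<Sum>W\<in>S. bit_sign i W))"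
      unfolding l_def by (subst sum.swap) (simp add: sum_distrib_left)
    also have "\<dots> = (\<Sum>i\<in>V. card S * (b i)\<^sup>2)"
      using N by (intro sum.cong) (auto simp: b_def power2_eq_square)
    finally show ?thesis by (simp add: M_def sum_distrib_left)
  qed
  \<comment> \<open>The tangent \<open>1 + u \<le> exp u\<close> at \<open>u = l W - M\<close>
    stands in for Jensen's inequality.\<close>
  have "card S * exp M = exp M * (\<Sum>W\<in>S. 1 + (l W - M))"
    using l_sum by (simp add: sum.distrib sum_subtractf)
  also have "\<dots> \<le> exp M * (\<Sum>W\<in>S. exp (l W - M))"
    by (intro mult_left_mono sum_mono exp_ge_add_one_self) auto
  also have "\<dots> = (\<Sum>W\<in>S. exp (l W))"
    by (simp add: sum_distrib_left flip: exp_add)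
  \<comment> \<open>Over the full cube the coordinates are independent, so the sum becomes a
    product.\<close>
  also have "\<dots> \<le> (\<Sum>W\<in>Pow V. exp (l W))"
    using V S by (intro sum_mono2) auto
  also have "\<dots> = (\<Sum>W\<in>Pow V. (\<Prod>i\<in>W. exp (b i)) * (\<Prod>i\<in>V - W. exp (- b i)))"
  proof (rule sum.cong)
    fix W assume "W \<in> Pow V"
    then have W: "W \<subseteq> V" by simp
    have "exp (l W) = (\<Prod>i\<in>V. exp (b i * bit_sign i W))"
      using V by (simp add: l_def exp_sum)
    also have "\<dots> = (\<Prod>i\<in>V - W. exp (b i * bit_sign i W)) * (\<Prod>i\<in>W. exp (b i * bit_sign i W))"
      using prod.subset_diff[OF W V] by simp
    also have "\<dots> = (\<Prod>i\<in>V - W. exp (- b i)) * (\<Prod>i\<in>W. exp (b i))"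
      by (intro arg_cong2[where f = "(*)"] prod.cong) (auto simp: bit_sign_def)
    finally show "exp (l W) = (\<Prod>i\<in>W. exp (b i)) * (\<Prod>i\<in>V - W. exp (- b i))"
      by simp
  qed simp
  also have "\<dots> = (\<Prod>i\<in>V. exp (b i) + exp (- b i))"
    using V by (simp add: prod_add)
  also have "\<dots> \<le> (\<Prod>i\<in>V. 2 * exp ((b i)\<^sup>2 / 2))"
  proof (intro prod_mono conjI)
    fix i
    show "exp (b i) + exp (- b i) \<le> 2 * exp ((b i)\<^sup>2 / 2)"
      using cosh_le_exp_half_square[of "b i"] by (simp add: cosh_def)
  qed (auto intro: add_nonneg_nonneg)
  also have "\<dots> = 2 ^ card V * exp (M / 2)"
    using V by (simp add: prod.distrib M_def exp_sum sum_divide_distrib)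
  finally have "card S * exp M \<le> 2 ^ card V * exp (M / 2)" .
  then have "exp M \<le> 2 ^ card V / card S * exp (M / 2)"
    using N by (simp add: field_simps)
  moreover have "exp M = exp (M / 2) * exp (M / 2)"
    by (simp flip: exp_add)
  ultimately have "exp (M / 2) \<le> 2 ^ card V / card S"
    by (metis exp_gt_zero mult_le_cancel_right_pos)
  then have "M \<le> 2 * ln (2 ^ card V / card S)"
    using ln_ge_iff[of "2 ^ card V / real (card S)" "M / 2"] N by simp
  then have "(card S)\<^sup>2 * M \<le> (card S)\<^sup>2 * (2 * ln (2 ^ card V / card S))"
    by (intro mult_left_mono) auto
  moreover have "(card S)\<^sup>2 * M = (\<Sum>i\<in>V. (\<Sum>W\<in>S. bit_sign i W)\<^sup>2)"
    using N by (simp add: M_def b_def sum_distrib_left power_divide)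
  ultimately show ?thesis by (simp add: mult_ac)
qed

text \<open>Factor \<open>x - y\<close> through the square roots; the square of
  \<open>sqrt x + sqrt y\<close> is at least \<open>x + y\<close>. This turns the squared bias of a
  class into a Hellinger term.\<close>

lemma diff_sqrt_square_le:
  fixes x y :: real
  assumes "x \<ge> 0" "y \<ge> 0"
  shows "(sqrt x - sqrt y)\<^sup>2 * (x + y) \<le> (x - y)\<^sup>2"
proof -
  have "(sqrt x - sqrt y)\<^sup>2 * (x + y) \<le> (sqrt x - sqrt y)\<^sup>2 * (sqrt x + sqrt y)\<^sup>2"
    using assms by (intro mult_left_mono) (auto simp: power2_sum)
  also have "\<dots> = ((sqrt x)\<^sup>2 - (sqrt y)\<^sup>2)\<^sup>2"
    by (simp add: power2_eq_square algebra_simps)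
  finally show ?thesis using assms by simp
qed

text \<open>Plays the role of the chain rule for mutual information in the information-complexity proof
  of the lower bound for disjointness.\<close>

lemma sum_hellinger_le:
  fixes V :: "'a set" and f :: "'a set \<Rightarrow> 'c"
  assumes V: "finite V" and T: "finite T" and f: "f ` Pow V \<subseteq> T"
  shows "(\<Sum>i\<in>V. \<Sum>\<tau>\<in>T. (sqrt (card {W \<in> Pow V. f W = \<tau> \<and> i \<in> W})
            - sqrt (card {W \<in> Pow V. f W = \<tau> \<and> i \<notin> W}))\<^sup>2) \<le> 2 * 2 ^ card V * ln (card T)"
proof -
  define S where "S \<tau> = {W \<in> Pow V. f W = \<tau>}" for \<tau>
  define n where "n \<tau> = real (card (S \<tau>))" for \<tau>
  define h where "h i \<tau> = (sqrt (card {W \<in> Pow V. f W = \<tau> \<and> i \<in> W})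
            - sqrt (card {W \<in> Pow V. f W = \<tau> \<and> i \<notin> W}))\<^sup>2" for i \<tau>
  have finS: "finite (S \<tau>)" for \<tau> using V by (simp add: S_def)
  have n_sum: "(\<Sum>\<tau>\<in>T. n \<tau>) = 2 ^ card V"
  proof -
    have "(\<Sum>\<tau>\<in>T. \<Sum>W\<in>{W. W \<in> Pow V \<and> f W = \<tau>}. 1::real) = (\<Sum>W\<in>Pow V. 1)"
      using V T f by (intro sum.group) auto
    then show ?thesis using V by (simp add: n_def S_def card_Pow)
  qed
  have "T \<noteq> {}" using f by auto
  then have cT: "real (card T) > 0" using T by (simp add: card_gt_0_iff)
  \<comment> \<open>The size of a class is compared with the average size
    \<open>2 ^ card V / card T\<close> through \<open>ln u \<le> u - 1\<close>. The bound is affine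
    in \<open>n \<tau>\<close>, and its first summand adds up to zero over \<open>T\<close>.\<close>
  have class_bound: "(\<Sum>i\<in>V. h i \<tau>) \<le> 2 * (2 ^ card V / card T - n \<tau>) + 2 * n \<tau> * ln (card T)" for \<tau>
  proof (cases "S \<tau> = {}")
    case True
    then have "{W \<in> Pow V. f W = \<tau> \<and> i \<in> W} = {}" "{W \<in> Pow V. f W = \<tau> \<and> i \<notin> W} = {}" for i
      by (auto simp: S_def)
    then have "h i \<tau> = 0" for i by (simp only: h_def) simp
    then show ?thesis using True by (simp add: n_def)
  next
    case False
    then have n: "n \<tau> > 0" using finS by (simp add: n_def card_gt_0_iff)
    have "n \<tau> * (\<Sum>i\<in>V. h i \<tau>) \<le> (\<Sum>i\<in>V. (\<Sum>W\<in>S \<tau>. bit_sign i W)\<^sup>2)"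
      unfolding sum_distrib_left
    proof (rule sum_mono)
      fix i
      let ?P = "{W \<in> Pow V. f W = \<tau> \<and> i \<in> W}" and ?Q = "{W \<in> Pow V. f W = \<tau> \<and> i \<notin> W}"
      have S_eq: "S \<tau> = ?P \<union> ?Q" by (auto simp: S_def)
      have fin: "finite ?P" "finite ?Q" using V by auto
      have n_eq: "n \<tau> = real (card ?P) + real (card ?Q)"
        unfolding n_def S_eq by (subst card_Un_disjoint) (use fin in auto)
      have "(\<Sum>W\<in>S \<tau>. bit_sign i W) = (\<Sum>W\<in>?P. bit_sign i W) + (\<Sum>W\<in>?Q. bit_sign i W)"
        unfolding S_eq by (rule sum.union_disjoint) (use fin in auto)
      also have "(\<Sum>W\<in>?P. bit_sign i W) = real (card ?P)"
        by (simp add: bit_sign_def)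
      also have "(\<Sum>W\<in>?Q. bit_sign i W) = - real (card ?Q)"
        by (simp add: bit_sign_def)
      finally have "(\<Sum>W\<in>S \<tau>. bit_sign i W) = real (card ?P) - real (card ?Q)" by simp
      then show "n \<tau> * h i \<tau> \<le> (\<Sum>W\<in>S \<tau>. bit_sign i W)\<^sup>2"
        using diff_sqrt_square_le[of "real (card ?P)" "real (card ?Q)"]
        by (simp add: n_eq h_def mult.commute)
    qed
    also have "\<dots> \<le> 2 * (n \<tau>)\<^sup>2 * ln (2 ^ card V / n \<tau>)"
      unfolding n_def using False V by (intro level_one_inequality) (auto simp: S_def)
    finally have "(\<Sum>i\<in>V. h i \<tau>) \<le> 2 * n \<tau> * ln (2 ^ card V / n \<tau>)"
      using n by (simp add: power2_eq_square)
    also have "2 ^ card V / n \<tau> = (2 ^ card V / (n \<tau> * card T)) * card T"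
      using cT by simp
    also have "ln \<dots> = ln (2 ^ card V / (n \<tau> * card T)) + ln (card T)"
      using n cT by (subst ln_mult) auto
    also have "2 * n \<tau> * \<dots> \<le> 2 * n \<tau> * ((2 ^ card V / (n \<tau> * card T) - 1) + ln (card T))"
      using n cT by (intro mult_left_mono add_right_mono ln_le_minus_one) auto
    also have "\<dots> = 2 * (2 ^ card V / card T - n \<tau>) + 2 * n \<tau> * ln (card T)"
      using n cT by (simp add: field_simps)
    finally show ?thesis .
  qed
  have "(\<Sum>i\<in>V. \<Sum>\<tau>\<in>T. h i \<tau>) = (\<Sum>\<tau>\<in>T. \<Sum>i\<in>V. h i \<tau>)"
    by (rule sum.swap)
  also have "\<dots> \<le> (\<Sum>\<tau>\<in>T. 2 * (2 ^ card V / card T - n \<tau>) + 2 * n \<tau> * ln (card T))"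
    by (intro sum_mono class_bound)
  also have "\<dots> = 2 * (2 ^ card V - (\<Sum>\<tau>\<in>T. n \<tau>)) + 2 * (\<Sum>\<tau>\<in>T. n \<tau>) * ln (card T)"
    using cT by (simp add: sum.distrib sum_subtractf sum_distrib_left sum_distrib_right right_diff_distrib)
  finally show ?thesis by (simp add: n_sum h_def)
qed

section \<open>Rectangles and acceptance gaps\<close>

lemma sum_Pow_split:
  fixes f :: "'a set \<Rightarrow> 'b::comm_monoid_add"
  assumes "finite V" "i \<in> V"
  shows "(\<Sum>D\<in>Pow V. f D) = (\<Sum>C\<in>Pow (V - {i}). f C + f (insert i C))"
proof -
  have V: "V = insert i (V - {i})" using assms by auto
  have inj: "inj_on (insert i) (Pow (V - {i}))"
    by (intro inj_onI) blast
  have "(\<Sum>D\<in>Pow V. f D) = (\<Sum>D\<in>Pow (V - {i}) \<union> insert i ` Pow (V - {i}). f D)"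
    using V Pow_insert[of i "V - {i}"] by simp
  also have "\<dots> = (\<Sum>C\<in>Pow (V - {i}). f C) + (\<Sum>D\<in>insert i ` Pow (V - {i}). f D)"
    using assms by (intro sum.union_disjoint) auto
  also have "(\<Sum>D\<in>insert i ` Pow (V - {i}). f D) = (\<Sum>C\<in>Pow (V - {i}). f (insert i C))"
    using inj by (simp add: sum.reindex)
  finally show ?thesis by (simp add: sum.distrib)
qed

text \<open>The parts of a subset inside and outside \<open>C\<close> are chosen
  independently.\<close>

lemma card_Pow_split:
  assumes "finite U" "C \<subseteq> U"
  shows "card {W \<in> Pow U. P (W \<inter> C) \<and> Q (W - C)}
    = card {X \<in> Pow C. P X} * card {Y \<in> Pow (U - C). Q Y}"
proof -
  have "bij_betw (\<lambda>W. (W \<inter> C, W - C)) {W \<in> Pow U. P (W \<inter> C) \<and> Q (W - C)}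
      ({X \<in> Pow C. P X} \<times> {Y \<in> Pow (U - C). Q Y})"
  proof (rule bij_betw_byWitness[where f' = "\<lambda>(X, Y). X \<union> Y"])
    have "X \<subseteq> C \<Longrightarrow> Y \<subseteq> U - C \<Longrightarrow> 
        X \<subseteq> U \<and> Y \<subseteq> U \<and> (X \<union> Y) \<inter> C = X \<and> (X \<union> Y) - C = Y" for X Y
      using assms by blast
    then show "\<forall>z\<in>{X \<in> Pow C. P X} \<times> {Y \<in> Pow (U - C). Q Y}.
        (\<lambda>W. (W \<inter> C, W - C)) (case z of (X, Y) \<Rightarrow> X \<union> Y) = z"
      and "(\<lambda>(X, Y). X \<union> Y) ` ({X \<in> Pow C. P X} \<times> {Y \<in> Pow (U - C). Q Y})
        \<subseteq> {W \<in> Pow U. P (W \<inter> C) \<and> Q (W - C)}"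
      using assms by (auto 0 0) blast+
  qed (auto simp: Int_Diff_Un)
  then show ?thesis
    by (simp add: bij_betw_same_card card_cartesian_product)
qed

text \<open>The rectangle property of communication protocols: every fibre of \<open>T\<close> is a
  product of a set of first inputs and a set of second inputs.\<close>

definition cut_and_paste :: "('a \<Rightarrow> 'b \<Rightarrow> 'c) \<Rightarrow> bool" where
  "cut_and_paste T \<longleftrightarrow> (\<forall>a b a' b'. T a b = T a' b' \<longrightarrow> T a b' = T a b)"

text \<open>As the fibre is a product \<open>E \<times> F\<close>, the count
  \<open>N p q \<tau>\<close> is a factor depending on \<open>p\<close> times a factor depending on
  \<open>q\<close>.\<close>

lemma cut_and_paste_card_mult:
  fixes T :: "'a set \<Rightarrow> 'a set \<Rightarrow> 'c"
  assumes T: "cut_and_paste T" and U: "finite U" "C \<subseteq> U"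
  defines "N \<equiv> \<lambda>p q \<tau>. card {W \<in> Pow U. T (p (W \<inter> C)) (q (W - C)) = \<tau>}"
  shows "N p q \<tau> * N p' q' \<tau> = N p q' \<tau> * N p' q \<tau>"
proof -
  define E where "E = {a. \<exists>b. T a b = \<tau>}"
  define F where "F = {b. \<exists>a. T a b = \<tau>}"
  have "T a b = \<tau> \<longleftrightarrow> a \<in> E \<and> b \<in> F" for a b
    using T unfolding cut_and_paste_def E_def F_def by (smt (verit) mem_Collect_eq)
  then have "N p q \<tau> = card {X \<in> Pow C. p X \<in> E} * card {Y \<in> Pow (U - C). q Y \<in> F}" for p q
    unfolding N_def using card_Pow_split[OF U, of "\<lambda>X. p X \<in> E" "\<lambda>Y. q Y \<in> F"] by simp
  then show ?thesis by simp
qed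

text \<open>\<open>C\<close> holds the indices owned by the first player, and \<open>W\<close> is a
  random choice of the owners. Cut and paste equates the distance between changing both players'
  maps and changing none with the distance between the two single changes; the triangle inequality
  splits the latter, and Cauchy-Schwarz passes from Hellinger distance to acceptance.\<close>

lemma acceptance_gap_le:
  fixes T :: "'a set \<Rightarrow> 'a set \<Rightarrow> 'c"
  assumes T: "cut_and_paste T" and S: "finite S" "\<And>a b. T a b \<in> S" and U: "finite U" "C \<subseteq> U"
  defines "N \<equiv> \<lambda>p q \<tau>. real (card {W \<in> Pow U. T (p (W \<inter> C)) (q (W - C)) = \<tau>})"
  shows "(\<Sum>W\<in>Pow U. of_bool (acc (T (p' (W \<inter> C)) (q' (W - C)))) - of_bool (acc (T (p (W \<inter> C)) (q (W - C)))) :: real)\<^sup>2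
    \<le> 8 * 2 ^ card U * ((\<Sum>\<tau>\<in>S. (sqrt (N p q' \<tau>) - sqrt (N p q \<tau>))\<^sup>2)
                         + (\<Sum>\<tau>\<in>S. (sqrt (N p' q \<tau>) - sqrt (N p q \<tau>))\<^sup>2))"
proof -
  have N_nonneg: "N p q \<tau> \<ge> 0" for p q \<tau> by (simp add: N_def)
  have N_sum: "(\<Sum>\<tau>\<in>S. N p q \<tau>) = 2 ^ card U" for p q
  proof -
    have "(\<Sum>\<tau>\<in>S. \<Sum>W\<in>{W. W \<in> Pow U \<and> T (p (W \<inter> C)) (q (W - C)) = \<tau>}. 1::real) = (\<Sum>W\<in>Pow U. 1)"
      using U S by (intro sum.group) auto
    then show ?thesis using U by (simp add: N_def card_Pow)
  qed
  have acc_sum: "(\<Sum>W\<in>Pow U. of_bool (acc (T (p (W \<inter> C)) (q (W - C))))) = (\<Sum>\<tau>\<in>S. of_bool (acc \<tau>) * N p q \<tau>)" for p q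
  proof -
    have "(\<Sum>W\<in>Pow U. of_bool (acc (T (p (W \<inter> C)) (q (W - C))))::real)
      = (\<Sum>\<tau>\<in>S. \<Sum>W\<in>{W. W \<in> Pow U \<and> T (p (W \<inter> C)) (q (W - C)) = \<tau>}. of_bool (acc (T (p (W \<inter> C)) (q (W - C)))))"
      using U S by (intro sum.group[symmetric]) auto
    also have "\<dots> = (\<Sum>\<tau>\<in>S. \<Sum>W\<in>{W. W \<in> Pow U \<and> T (p (W \<inter> C)) (q (W - C)) = \<tau>}. of_bool (acc \<tau>))"
      by (intro sum.cong) auto
    finally show ?thesis by (simp add: N_def mult.commute)
  qed
  define H where "H p q p' q' = (\<Sum>\<tau>\<in>S. (sqrt (N p q \<tau>) - sqrt (N p' q' \<tau>))\<^sup>2)" for p q p' q'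
  have H_eq: "H p q p' q' = 2 * 2 ^ card U - 2 * (\<Sum>\<tau>\<in>S. sqrt (N p q \<tau> * N p' q' \<tau>))" for p q p' q'
    by (simp add: H_def power2_diff N_nonneg sum.distrib sum_subtractf N_sum real_sqrt_mult
        sum_distrib_left mult.assoc)
  \<comment> \<open>By \<open>H_eq\<close> the distance depends only on the affinity, in which
    \<open>q\<close> and \<open>q'\<close> may be swapped.\<close>
  have "N p' q' \<tau> * N p q \<tau> = N p q' \<tau> * N p' q \<tau>" for \<tau>
    using cut_and_paste_card_mult[OF T U, of p q \<tau> p' q'] unfolding N_def
    by (simp flip: of_nat_mult add: mult.commute)
  then have paste: "H p' q' p q = H p q' p' q"
    by (simp add: H_eq)
  also have "\<dots> \<le> (\<Sum>\<tau>\<in>S. 2 * (sqrt (N p q' \<tau>) - sqrt (N p q \<tau>))\<^sup>2 + 2 * (sqrt (N p' q \<tau>) - sqrt (N p q \<tau>))\<^sup>2)"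
    unfolding H_def
  proof (rule sum_mono)
    have "(x - z)\<^sup>2 \<le> 2 * (x - y)\<^sup>2 + 2 * (z - y)\<^sup>2" for x y z :: real
      using zero_le_power2[of "x + z - 2 * y"] by (simp add: power2_eq_square algebra_simps)
    then show "(sqrt (N p q' \<tau>) - sqrt (N p' q \<tau>))\<^sup>2
      \<le> 2 * (sqrt (N p q' \<tau>) - sqrt (N p q \<tau>))\<^sup>2 + 2 * (sqrt (N p' q \<tau>) - sqrt (N p q \<tau>))\<^sup>2" for \<tau> .
  qed
  also have "\<dots> = 2 * (H p q' p q + H p' q p q)"
    by (simp add: H_def sum.distrib sum_distrib_left)
  finally have triangle: "H p' q' p q \<le> 2 * (H p q' p q + H p' q p q)" .
  let ?G = "\<Sum>W\<in>Pow U. of_bool (acc (T (p' (W \<inter> C)) (q' (W - C)))) - of_bool (acc (T (p (W \<inter> C)) (q (W - C)))) :: real"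
  have "?G = (\<Sum>\<tau>\<in>S. (sqrt (N p' q' \<tau>) - sqrt (N p q \<tau>)) * (of_bool (acc \<tau>) * (sqrt (N p' q' \<tau>) + sqrt (N p q \<tau>))))"
    using N_nonneg
    by (simp add: sum_subtractf acc_sum algebra_simps flip: power2_eq_square)
  then have "?G\<^sup>2 \<le> H p' q' p q * (\<Sum>\<tau>\<in>S. (of_bool (acc \<tau>) * (sqrt (N p' q' \<tau>) + sqrt (N p q \<tau>)))\<^sup>2)"
    unfolding H_def by (simp only: Cauchy_Schwarz_ineq_sum)
  also have "\<dots> \<le> H p' q' p q * (\<Sum>\<tau>\<in>S. 2 * N p' q' \<tau> + 2 * N p q \<tau>)"
  proof (intro mult_left_mono sum_mono)
    have sq: "(x + y)\<^sup>2 \<le> 2 * x\<^sup>2 + 2 * y\<^sup>2" for x y :: real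
      using zero_le_power2[of "x - y"] by (simp add: power2_eq_square algebra_simps)
    show "(of_bool (acc \<tau>) * (sqrt (N p' q' \<tau>) + sqrt (N p q \<tau>)))\<^sup>2 \<le> 2 * N p' q' \<tau> + 2 * N p q \<tau>" for \<tau>
      using sq[of "sqrt (N p' q' \<tau>)" "sqrt (N p q \<tau>)"] N_nonneg by (cases "acc \<tau>") auto
  qed (auto simp: H_def intro: sum_nonneg)
  also have "\<dots> = H p' q' p q * (4 * 2 ^ card U)"
    by (simp add: sum.distrib N_sum flip: sum_distrib_left)
  also have "\<dots> \<le> 2 * (H p q' p q + H p' q p q) * (4 * 2 ^ card U)"
    using triangle by (intro mult_right_mono) auto
  also have "\<dots> = 8 * 2 ^ card U * (H p q' p q + H p' q p q)"
    by simp
  finally show ?thesis unfolding H_def .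
qed

text \<open>For a fixed set \<open>D\<close> of indices owned by the first player,
  \<open>sum_hellinger_le\<close> bounds the influence of all indices on the transcript at once. The
  gap at \<open>i\<close> needs both possible owners of \<open>i\<close>, that is \<open>C\<close>
  and \<open>insert i C\<close>; over all \<open>C\<close> these run through every \<open>D\<close>
  exactly once.\<close>

lemma sum_acceptance_gap_le:
  fixes T :: "'a set \<Rightarrow> 'a set \<Rightarrow> 'c"
  assumes T: "cut_and_paste T" and S: "finite S" "\<And>a b. T a b \<in> S" and V: "finite V"
  shows "(\<Sum>i\<in>V. \<Sum>C\<in>Pow (V - {i}). (\<Sum>W\<in>Pow (V - {i}).
      of_bool (acc (T (insert i (W \<inter> C)) (insert i (W - C)))) - of_bool (acc (T (W \<inter> C) (W - C))) :: real)\<^sup>2)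
    \<le> 8 * (2 ^ card V) ^ 3 * ln (card S)"
proof -
  define H where "H D i = (\<Sum>\<tau>\<in>S. (sqrt (card {W \<in> Pow V. T (W \<inter> D) (W - D) = \<tau> \<and> i \<in> W})
            - sqrt (card {W \<in> Pow V. T (W \<inter> D) (W - D) = \<tau> \<and> i \<notin> W}))\<^sup>2)" for D i
  let ?G = "\<lambda>i C. (\<Sum>W\<in>Pow (V - {i}).
      of_bool (acc (T (insert i (W \<inter> C)) (insert i (W - C)))) - of_bool (acc (T (W \<inter> C) (W - C))) :: real)"
  have gap: "(?G i C)\<^sup>2 \<le> 4 * 2 ^ card V * (H C i + H (insert i C) i)"
    if i: "i \<in> V" and C: "C \<in> Pow (V - {i})" for i C
  proof -
    have inj: "inj_on (insert i) {W \<in> Pow (V - {i}). P W}" for P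
      by (intro inj_onI) blast
    have with_i: "card {W \<in> Pow V. P W \<and> i \<in> W} = card {W \<in> Pow (V - {i}). P (insert i W)}" for P
    proof -
      have "{W \<in> Pow V. P W \<and> i \<in> W} = insert i ` {W \<in> Pow (V - {i}). P (insert i W)}"
      proof (intro subset_antisym subsetI)
        fix W assume "W \<in> {W \<in> Pow V. P W \<and> i \<in> W}"
        then have "W = insert i (W - {i})" "W - {i} \<in> {W \<in> Pow (V - {i}). P (insert i W)}"
          by (auto simp: insert_absorb)
        then show "W \<in> insert i ` {W \<in> Pow (V - {i}). P (insert i W)}" by (rule image_eqI)
      qed (use i in auto)
      then show ?thesis using inj by (simp only: card_image)
    qed
    have without_i: "{W \<in> Pow V. P W \<and> i \<notin> W} = {W \<in> Pow (V - {i}). P W}" for P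
      by auto
    have iC: "i \<notin> C" using C by auto
    have r1: "insert i W \<inter> C = W \<inter> C" "insert i W - C = insert i (W - C)" for W
      using iC by auto
    have r2: "insert i W \<inter> insert i C = insert i (W \<inter> C)" for W
      by auto
    have r3: "insert i W - insert i C = W - C" "W \<inter> insert i C = W \<inter> C" "W - insert i C = W - C" 
      if "W \<in> Pow (V - {i})" for W
      using iC that by auto
    \<comment> \<open>For \<open>C\<close> the second player owns \<open>i\<close> and may add it,
      for \<open>insert i C\<close> the first does; \<open>id\<close> stands for the player who
      leaves the set unchanged.\<close>
    have H1: "H C i = (\<Sum>\<tau>\<in>S. (sqrt (real (card {W \<in> Pow (V - {i}). T (id (W \<inter> C)) (insert i (W - C)) = \<tau>}))
        - sqrt (real (card {W \<in> Pow (V - {i}). T (id (W \<inter> C)) (id (W - C)) = \<tau>})))\<^sup>2)"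
      unfolding H_def with_i without_i r1 id_apply ..
    have H2: "H (insert i C) i = (\<Sum>\<tau>\<in>S. (sqrt (real (card {W \<in> Pow (V - {i}). T (insert i (W \<inter> C)) (id (W - C)) = \<tau>}))
        - sqrt (real (card {W \<in> Pow (V - {i}). T (id (W \<inter> C)) (id (W - C)) = \<tau>})))\<^sup>2)"
      unfolding H_def with_i without_i r2 id_apply
      by (simp only: r3 cong: conj_cong)
    have "card V = Suc (card (V - {i}))"
      using V i by (rule card.remove)
    then have K: "8 * 2 ^ card (V - {i}) = 4 * (2::real) ^ card V" by simp
    have "finite (V - {i})" "C \<subseteq> V - {i}" using V C by auto
    from acceptance_gap_le[OF T S this, of acc "insert i" "insert i" id id, folded H1 H2]
    show ?thesis by (simp only: K id_apply)
  qed
  have "(\<Sum>i\<in>V. \<Sum>C\<in>Pow (V - {i}). (?G i C)\<^sup>2)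
      \<le> (\<Sum>i\<in>V. \<Sum>C\<in>Pow (V - {i}). 4 * 2 ^ card V * (H C i + H (insert i C) i))"
    by (intro sum_mono gap)
  also have "\<dots> = (\<Sum>i\<in>V. 4 * 2 ^ card V * (\<Sum>D\<in>Pow V. H D i))"
    by (intro sum.cong refl, subst sum_Pow_split[OF V]) (simp_all add: sum_distrib_left)
  also have "\<dots> = 4 * 2 ^ card V * (\<Sum>i\<in>V. \<Sum>D\<in>Pow V. H D i)"
    by (simp add: sum_distrib_left)
  also have "(\<Sum>i\<in>V. \<Sum>D\<in>Pow V. H D i) = (\<Sum>D\<in>Pow V. \<Sum>i\<in>V. H D i)"
    by (rule sum.swap)
  also have "4 * 2 ^ card V * \<dots> \<le> 4 * 2 ^ card V * (\<Sum>D\<in>Pow V. 2 * 2 ^ card V * ln (card S))"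
    unfolding H_def using V S by (intro mult_left_mono sum_mono sum_hellinger_le) auto
  also have "\<dots> = 8 * (2 ^ card V) ^ 3 * ln (card S)"
    using V by (simp add: card_Pow power3_eq_cube)
  finally show ?thesis .
qed

section \<open>Streaming algorithms and transcripts\<close>

text \<open>The memory contents at the segment borders are the messages of a protocol:
  \<open>f\<close> and \<open>h\<close> see the first input only, \<open>g\<close> the second only.
  All of them are recorded because the final content alone need not determine a rectangle.\<close>

primrec transcript ::
    "(nat \<Rightarrow> 'm \<Rightarrow> 'a \<Rightarrow> 'm) \<Rightarrow> (nat \<Rightarrow> 'm \<Rightarrow> 'b \<Rightarrow> 'm) \<Rightarrow> (nat \<Rightarrow> 'm \<Rightarrow> 'a \<Rightarrow> 'm)
      \<Rightarrow> 'm \<Rightarrow> nat \<Rightarrow> 'a \<Rightarrow> 'b \<Rightarrow> 'm list" where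
  "transcript f g h m 0 a b = []"
| "transcript f g h m (Suc r) a b =
    (let \<tau> = transcript f g h m r a b; u = f r (last (m # \<tau>)) a; v = g r u b
     in \<tau> @ [u, v, h r v a])"

lemma length_transcript [simp]: "length (transcript f g h m r a b) = 3 * r"
  by (induction r) (auto simp: Let_def)

text \<open>Each message is a function of the earlier ones and of one input, so mixing the inputs of
  two runs with equal transcripts reproduces every message.\<close>

lemma cut_and_paste_transcript: "cut_and_paste (transcript f g h m r)"
proof (induction r)
  case (Suc r)
  show ?case
    unfolding cut_and_paste_def
  proof (intro allI impI)
    fix a b a' b'
    assume eq: "transcript f g h m (Suc r) a b = transcript f g h m (Suc r) a' b'"
    then have prev: "transcript f g h m r a b = transcript f g h m r a' b'"
      by (simp add: Let_def)
    then have "transcript f g h m r a b' = transcript f g h m r a b"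
      using Suc unfolding cut_and_paste_def by blast
    then show "transcript f g h m (Suc r) a b' = transcript f g h m (Suc r) a b"
      using eq prev by (auto simp: Let_def)
  qed
qed (simp add: cut_and_paste_def)

lemma set_transcript_subset:
  assumes "m \<in> M" "\<And>r x a. x \<in> M \<Longrightarrow> f r x a \<in> M" "\<And>r x b. x \<in> M \<Longrightarrow> g r x b \<in> M"
    "\<And>r x a. x \<in> M \<Longrightarrow> h r x a \<in> M"
  shows "set (transcript f g h m r a b) \<subseteq> M"
proof (induction r)
  case (Suc r)
  have "last (m # transcript f g h m r a b) \<in> set (m # transcript f g h m r a b)"
    by (rule last_in_set) simp
  then have "last (m # transcript f g h m r a b) \<in> M"
    using Suc assms(1) by auto
  then show ?case using Suc assms by (auto simp: Let_def)
qed simp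

lemma run_pass_append:
  "run_pass A y r i m (x @ x') = run_pass A y r (i + length x) (run_pass A y r i m x) x'"
  by (induction x arbitrary: i m) auto

lemma length_run_pass:
  assumes "\<And>y r i m a. length m = s \<Longrightarrow> length (step A y r i m a) = s" "length m = s"
  shows "length (run_pass A y r i m x) = s"
  using assms(2) by (induction x arbitrary: i m) (auto simp: assms(1))

text \<open>The final content is the last message; the \<open>m\<close> in front covers the case of
  no pass.\<close>

lemma fold_run_pass_eq_transcript:
  assumes "length (p a) = l" "length (q b) = l'"
  shows "fold (\<lambda>r m. run_pass A y r 0 m (p a @ q b @ p' a)) [0..<R] m
    = last (m # transcript (\<lambda>r m a. run_pass A y r 0 m (p a)) (\<lambda>r m b. run_pass A y r l m (q b))
        (\<lambda>r m a. run_pass A y r (l + l') m (p' a)) m R a b)"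
  by (induction R) (auto simp: run_pass_append assms Let_def)

text \<open>The last segment \<open>p' a\<close> is needed because the multiset of the whole stream is prescribed. The
  lengths \<open>l\<close> and \<open>l'\<close> must not depend on the sets: an algorithm knows the position in the stream,
  so they would leak information that is not part of the transcript.\<close>

definition disjointness_embedding ::
    "nat \<Rightarrow> nat \<Rightarrow> ('a list \<times> 'a list) set \<Rightarrow> (nat set \<Rightarrow> 'a list) \<Rightarrow> (nat set \<Rightarrow> 'a list)
      \<Rightarrow> (nat set \<Rightarrow> 'a list) \<Rightarrow> 'a list \<Rightarrow> nat \<Rightarrow> nat \<Rightarrow> bool" where
  "disjointness_embedding t k I p q p' y l l' \<longleftrightarrow>
     (\<forall>a. length (p a) = l) \<and> (\<forall>b. length (q b) = l') \<and>
     (\<forall>a b. a \<subseteq> {..<t} \<longrightarrow> b \<subseteq> {..<t} \<longrightarrow> (p a @ q b @ p' a, y) \<in> I \<and>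
        (k \<le> lcs (p a @ q b @ p' a) y \<longleftrightarrow> a \<inter> b \<noteq> {}))"

text \<open>For each deterministic algorithm the squared acceptance gaps have a sum at most
  \<open>192 * M ^ 3 * (R * s)\<close>, whereas correctness forces every gap to have mean at least
  \<open>M / 3\<close>. Averaging gives the factor \<open>1728 = 9 * 192\<close>.\<close>

lemma space_ge_of_disjointness_embedding:
  fixes D :: "'a stream_alg pmf"
  assumes emb: "disjointness_embedding t k I p q p' y l l'" and space: "uses_space s D"
    and dec: "decides_lcs_ge R k I D"
  shows "real t \<le> 1728 * (real R * real s)"
proof (cases "t = 0")
  case False
  have len: "length (p a) = l" "length (q b) = l'" for a b
    using emb by (auto simp: disjointness_embedding_def)
  have I: "(p a @ q b @ p' a, y) \<in> I" and lcs: "k \<le> lcs (p a @ q b @ p' a) y \<longleftrightarrow> a \<inter> b \<noteq> {}"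
    if "a \<subseteq> {..<t}" "b \<subseteq> {..<t}" for a b
    using emb that by (auto simp: disjointness_embedding_def)
  define M :: real where "M = 2 ^ (t - 1)"
  have M: "M > 0" "2 ^ t = 2 * M" using False by (auto simp: M_def simp flip: power_Suc)
  define acc where "acc A a b = run A R (p a @ q b @ p' a) y" for A a b
  define G where "G A i C = (\<Sum>W\<in>Pow ({..<t} - {i}).
      of_bool (acc A (insert i (W \<inter> C)) (insert i (W - C))) - of_bool (acc A (W \<inter> C) (W - C)) :: real)"
    for A i C
  \<comment> \<open>\<open>Z\<close> replaces each squared gap by its tangent at
    \<open>M / 3\<close>, so that expectations can be taken by linearity.\<close>
  define Z where "Z A = (\<Sum>i<t. \<Sum>C\<in>Pow ({..<t} - {i}). 2 / 3 * M * G A i C - M\<^sup>2 / 9)" for A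
  have card_M: "real (card (Pow ({..<t} - {i}))) = M" if "i < t" for i
    using that by (simp add: card_Pow M_def)

  have Z_le: "Z A \<le> 192 * M ^ 3 * (real R * real s)" if A: "A \<in> set_pmf D" for A
  proof -
    define T where "T = transcript (\<lambda>r m a. run_pass A y r 0 m (p a)) (\<lambda>r m b. run_pass A y r l m (q b))
        (\<lambda>r m a. run_pass A y r (l + l') m (p' a)) (init A) R"
    define S where "S = {\<tau>. set \<tau> \<subseteq> {m::bool list. length m = s} \<and> length \<tau> = 3 * R}"
    have card_mem: "card {m::bool list. length m = s} = 2 ^ s" and fin_mem: "finite {m::bool list. length m = s}"
      using card_lists_length_eq[of "UNIV::bool set" s] finite_lists_length_eq[of "UNIV::bool set" s]
      by auto
    have S: "finite S" "card S = 2 ^ (s * (3 * R))"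
      using fin_mem card_mem
      by (auto simp: S_def finite_lists_length_eq card_lists_length_eq power_mult)
    have TS: "T a b \<in> S" for a b
      unfolding S_def T_def mem_Collect_eq
      by (intro conjI set_transcript_subset length_transcript)
        (use space A in \<open>auto simp: uses_space_def intro!: length_run_pass\<close>)
    have acc_eq: "acc A a b = out A y (last (init A # T a b))" for a b
      unfolding acc_def run_def T_def using fold_run_pass_eq_transcript[of p a l q b l'] len by simp
    have "2 / 3 * M * x - M\<^sup>2 / 9 \<le> x\<^sup>2" for x
      using zero_le_power2[of "x - M / 3"] by (simp add: power2_eq_square algebra_simps)
    then have "Z A \<le> (\<Sum>i<t. \<Sum>C\<in>Pow ({..<t} - {i}). (G A i C)\<^sup>2)"
      unfolding Z_def by (intro sum_mono)
    also have "\<dots> \<le> 8 * (2 ^ card {..<t}) ^ 3 * ln (card S)"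
      unfolding G_def acc_eq using S(1) TS
      by (intro sum_acceptance_gap_le) (auto simp: T_def cut_and_paste_transcript)
    also have "\<dots> = 64 * M ^ 3 * ln (card S)"
      by (simp add: M power_mult_distrib)
    also have "ln (card S) = real (s * (3 * R)) * ln 2"
      by (simp add: S ln_realpow)
    also have "64 * M ^ 3 * \<dots> \<le> 64 * M ^ 3 * (real (s * (3 * R)) * 1)"
      using M ln_2_less_1 by (intro mult_left_mono) simp_all
    finally show ?thesis by (simp add: mult_ac)
  qed

  have int: "integrable (measure_pmf D) (\<lambda>A. of_bool (acc A a b) :: real)" for a b
    by (rule measure_pmf.integrable_const_bound[where B = 1]) auto
  have int_G: "integrable (measure_pmf D) (\<lambda>A. G A i C)" for i C
    unfolding G_def by (intro Bochner_Integration.integrable_sum Bochner_Integration.integrable_diff int)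
  have E_acc: "(\<integral>A. of_bool (acc A a b) \<partial>measure_pmf D) = measure_pmf.prob D {A. acc A a b}" for a b
  proof -
    have "(\<lambda>A. of_bool (acc A a b)) = (indicator {A. acc A a b} :: _ \<Rightarrow> real)"
      by (auto simp: indicator_def)
    then show ?thesis by simp
  qed
  have yes: "measure_pmf.prob D {A. acc A a b} \<ge> 2 / 3" if "a \<subseteq> {..<t}" "b \<subseteq> {..<t}" "a \<inter> b \<noteq> {}" for a b
    using dec I[OF that(1,2)] lcs[OF that(1,2)] that(3)
    unfolding decides_lcs_ge_def acc_def by fastforce
  have no: "measure_pmf.prob D {A. acc A a b} \<le> 1 / 3" if "a \<subseteq> {..<t}" "b \<subseteq> {..<t}" "a \<inter> b = {}" for a b
  proof -
    have "measure_pmf.prob D {A. \<not> acc A a b} \<ge> 2 / 3"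
      using dec I[OF that(1,2)] lcs[OF that(1,2)] that(3)
      unfolding decides_lcs_ge_def acc_def by fastforce
    then show ?thesis
      using measure_pmf.prob_neg[of D "\<lambda>A. acc A a b"] by simp
  qed
  \<comment> \<open>As \<open>W\<close> and \<open>C\<close> avoid \<open>i\<close>, the enlarged
    sets meet exactly in \<open>i\<close>, while the original ones are disjoint.\<close>
  have E_G: "M / 3 \<le> (\<integral>A. G A i C \<partial>measure_pmf D)" if "i < t" "C \<in> Pow ({..<t} - {i})" for i C
  proof -
    have "M / 3 = (\<Sum>W\<in>Pow ({..<t} - {i}). 1 / 3)"
      using card_M[OF that(1)] by simp
    also have "\<dots> \<le> (\<Sum>W\<in>Pow ({..<t} - {i}). measure_pmf.prob D {A. acc A (insert i (W \<inter> C)) (insert i (W - C))}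
        - measure_pmf.prob D {A. acc A (W \<inter> C) (W - C)})"
    proof (rule sum_mono)
      fix W assume W: "W \<in> Pow ({..<t} - {i})"
      have "2 / 3 \<le> measure_pmf.prob D {A. acc A (insert i (W \<inter> C)) (insert i (W - C))}"
        using W that by (intro yes) auto
      moreover have "measure_pmf.prob D {A. acc A (W \<inter> C) (W - C)} \<le> 1 / 3"
        using W that by (intro no) auto
      ultimately show "1 / 3 \<le> measure_pmf.prob D {A. acc A (insert i (W \<inter> C)) (insert i (W - C))}
        - measure_pmf.prob D {A. acc A (W \<inter> C) (W - C)}" by linarith
    qed
    also have "\<dots> = (\<integral>A. G A i C \<partial>measure_pmf D)"
      unfolding G_def by (simp add: int E_acc)
    finally show ?thesis .
  qed
  have "real t * (M ^ 3 / 9) = (\<Sum>i<t. \<Sum>C\<in>Pow ({..<t} - {i}). 2 / 3 * M * (M / 3) - M\<^sup>2 / 9)"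
    using card_M by (simp add: power2_eq_square power3_eq_cube)
  also have "\<dots> \<le> (\<Sum>i<t. \<Sum>C\<in>Pow ({..<t} - {i}). 2 / 3 * M * (\<integral>A. G A i C \<partial>measure_pmf D) - M\<^sup>2 / 9)"
    using M E_G by (intro sum_mono diff_right_mono mult_left_mono) auto
  also have "\<dots> = (\<integral>A. Z A \<partial>measure_pmf D)"
    unfolding Z_def by (simp add: int_G)
  also have "\<dots> \<le> 192 * M ^ 3 * (real R * real s)"
  proof (rule measure_pmf.integral_le_const)
    show "integrable (measure_pmf D) Z"
      unfolding Z_def by (intro Bochner_Integration.integrable_sum Bochner_Integration.integrable_diff) (auto simp: int_G)
  qed (simp add: AE_measure_pmf_iff Z_le)
  finally show ?thesis
    using M by (simp add: field_simps)
qed simp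

section \<open>Longest common subsequences\<close>

lemma le_lcs_iff: "k \<le> lcs x y \<longleftrightarrow> (\<exists>z. subseq z x \<and> subseq z y \<and> k \<le> length z)"
proof -
  have "{length z |z. subseq z x \<and> subseq z y} \<subseteq> {..length x}"
    by (auto dest: list_emb_length)
  then have "finite {length z |z. subseq z x \<and> subseq z y}"
    using finite_subset by blast
  moreover have "length [] \<in> {length z |z. subseq z x \<and> subseq z y}"
    by (intro CollectI exI[of _ "[]"]) simp
  ultimately show ?thesis
    unfolding lcs_def by (subst Max_ge_iff) auto
qed

lemma lcs_map:
  assumes "inj_on e S" "set x \<subseteq> S" "set y \<subseteq> S"
  shows "lcs (map e x) (map e y) = lcs x y"
proof -
  have le: "lcs x y \<le> lcs (map f x) (map f y)" for f :: "'c \<Rightarrow> 'd" and x y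
    using le_lcs_iff[of "lcs x y" x y] le_lcs_iff[of "lcs x y" "map f x" "map f y"] subseq_map
    by (metis length_map order_refl)
  have "map (inv_into S e) (map e u) = u" if "set u \<subseteq> S" for u
    using assms(1) that by (auto intro!: map_idI)
  then show ?thesis
    using le[of x y e] le[of "map e x" "map e y" "inv_into S e"] assms by simp
qed

text \<open>In either string at most \<open>length r\<close> letters of a common subsequence are
  matched inside \<open>r\<close>, so dropping that many leaves a common subsequence of the
  remainders.\<close>

lemma le_lcs_common_prefix: "k + length r \<le> lcs (r @ u) (r @ v) \<longleftrightarrow> k \<le> lcs u v"
proof
  have drop: "subseq (drop (length r) z) u" if "subseq z (r @ u)" for z u
  proof -
    from that obtain z1 z2 where z: "z = z1 @ z2" "subseq z1 r" "subseq z2 u"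
      by (rule subseq_appendE)
    then have "drop (length r) z = drop (length r - length z1) z2"
      using list_emb_length[of "(=)" z1 r] by simp
    then show ?thesis
      using z(3) suffix_drop suffix_imp_subseq subseq_order.order_trans by metis
  qed
  assume "k + length r \<le> lcs (r @ u) (r @ v)"
  then obtain z where "subseq z (r @ u)" "subseq z (r @ v)" "k + length r \<le> length z"
    using le_lcs_iff by blast
  then have "subseq (drop (length r) z) u" "subseq (drop (length r) z) v" "k \<le> length (drop (length r) z)"
    using drop by auto
  then show "k \<le> lcs u v"
    using le_lcs_iff by blast
next
  assume "k \<le> lcs u v"
  then obtain z where "subseq z u" "subseq z v" "k \<le> length z"
    using le_lcs_iff by blast
  then have "subseq (r @ z) (r @ u)" "subseq (r @ z) (r @ v)" "k + length r \<le> length (r @ z)"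
    by (auto simp: subseq_append')
  then show "k + length r \<le> lcs (r @ u) (r @ v)"
    using le_lcs_iff by blast
qed

lemma subseq_set_subset: "subseq z x \<Longrightarrow> set z \<subseteq> set x"
  by (induction rule: list_emb.induct) auto

lemma sorted_wrt_subseq: "subseq z x \<Longrightarrow> sorted_wrt P x \<Longrightarrow> sorted_wrt P z"
  by (induction rule: list_emb.induct) (auto dest: subseq_set_subset)

text \<open>A common subsequence that starts in \<open>F\<close> cannot start in \<open>v\<close>,
  so it lies in \<open>F'\<close> and uses nothing of \<open>u\<close>: its length is at most
  \<open>lcs F F'\<close>. One that avoids \<open>F\<close> lies in \<open>u\<close> and hence
  avoids \<open>F'\<close>.\<close>

lemma le_lcs_crossing:
  assumes "set F \<inter> set v = {}" "set F' \<inter> set u = {}" "lcs F F' < k"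
  shows "k \<le> lcs (F @ u) (v @ F') \<longleftrightarrow> k \<le> lcs u v"
proof
  assume "k \<le> lcs (F @ u) (v @ F')"
  then obtain z where z: "subseq z (F @ u)" "subseq z (v @ F')" "k \<le> length z"
    using le_lcs_iff by blast
  from z(1) obtain z1 z2 where z12: "z = z1 @ z2" "subseq z1 F" "subseq z2 u"
    by (rule subseq_appendE)
  from z(2) obtain w1 w2 where w12: "z = w1 @ w2" "subseq w1 v" "subseq w2 F'"
    by (rule subseq_appendE)
  have sets: "set z1 \<subseteq> set F" "set z2 \<subseteq> set u" "set w1 \<subseteq> set v" "set w2 \<subseteq> set F'"
    using z12 w12 subseq_set_subset by blast+
  show "k \<le> lcs u v"
  proof (cases "z1 = []")
    case True
    then have "set w2 \<subseteq> set u" using z12 w12 sets by auto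
    then have "set w2 \<subseteq> set F' \<inter> set u" using sets(4) by (intro Int_greatest)
    then have "w2 = []" using assms(2) by simp
    then show ?thesis using True z12 w12 z(3) le_lcs_iff by fastforce
  next
    case False
    have "w1 = []"
    proof (rule ccontr)
      assume "w1 \<noteq> []"
      then have "hd z \<in> set w1" "hd z \<in> set z1" using False z12 w12 by (metis hd_append2 hd_in_set)+
      then show False using sets assms by auto
    qed
    then have "set z2 \<subseteq> set F'" using z12 w12 sets by (metis append_Nil set_append sup.boundedE)
    then have "set z2 \<subseteq> set F' \<inter> set u" using sets(2) by (intro Int_greatest)
    then have "z2 = []" using assms(2) by simp
    then have "length z \<le> lcs F F'" using \<open>w1 = []\<close> z12 w12 by (intro length_le_lcs) auto
    then show ?thesis using z(3) assms by simp
  qed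
next
  assume "k \<le> lcs u v"
  then obtain z where "subseq z u" "subseq z v" "k \<le> length z"
    using le_lcs_iff by blast
  then show "k \<le> lcs (F @ u) (v @ F')"
    using le_lcs_iff subseq_drop_many subseq_rev_drop_many by blast
qed

text \<open>A common subsequence is both weakly increasing and weakly decreasing, hence
  constant.\<close>

lemma lcs_sorted_rev_le:
  fixes F :: "'a::linorder list"
  assumes "sorted F" "\<And>a. count_list F a \<le> h"
  shows "lcs F (rev F) \<le> h"
proof -
  obtain z where z: "subseq z F" "subseq z (rev F)" "lcs F (rev F) \<le> length z"
    using le_lcs_iff by blast
  have "sorted z" "sorted (rev z)"
    using assms(1) z(1,2) by (auto intro: sorted_wrt_subseq simp: sorted_wrt_rev)
  show ?thesis
  proof (cases z)
    case (Cons a u)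
    have "x = a" if "x \<in> set z" for x
      using \<open>sorted z\<close> \<open>sorted (rev z)\<close> that by (auto simp: Cons sorted_append intro: antisym)
    then have "z = replicate (length z) a"
      by (simp add: replicate_eqI)
    then have "length z = count_list z a"
      by (metis count_mset count_replicate_mset mset_replicate)
    also have "\<dots> \<le> count_list F a"
      using z(1) by (induction rule: list_emb.induct) auto
    also have "\<dots> \<le> h" by (rule assms)
    finally show ?thesis using z(3) by simp
  qed (use z in simp)
qed

section \<open>Increasing chains\<close>

text \<open>Both players' words are permutations of fixed sets of three symbols per index, and both
  contain an increasing pair whatever the bit is; the bit only moves the position of the cut in
  \<open>[6 * i..<6 * i + 6]\<close> at which the second element becomes available.\<close>

definition chain_left :: "nat list \<Rightarrow> nat set \<Rightarrow> nat list" where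
  "chain_left js a = concat (map (\<lambda>i. if i \<in> a then [6 * i, 6 * i + 4, 6 * i + 2]
     else [6 * i + 2, 6 * i, 6 * i + 4]) js)"

definition chain_right :: "nat list \<Rightarrow> nat set \<Rightarrow> nat list" where
  "chain_right js b = concat (map (\<lambda>i. if i \<in> b then [6 * i + 3, 6 * i + 1, 6 * i + 5]
     else [6 * i + 1, 6 * i + 5, 6 * i + 3]) js)"

lemma chain_left_Nil [simp]: "chain_left [] a = []"
  and chain_left_append [simp]: "chain_left (js @ js') a = chain_left js a @ chain_left js' a"
  by (simp_all add: chain_left_def)

lemma chain_right_Nil [simp]: "chain_right [] b = []"
  and chain_right_append [simp]: "chain_right (js @ js') b = chain_right js b @ chain_right js' b"
  by (simp_all add: chain_right_def)

lemma length_chain_left [simp]: "length (chain_left js a) = 3 * length js"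
  by (induction js) (auto simp: chain_left_def)

lemma length_chain_right [simp]: "length (chain_right js b) = 3 * length js"
  by (induction js) (auto simp: chain_right_def)

lemma div_6: "Suc (6 * i) div 6 = i" "Suc (Suc (6 * i)) div 6 = i"
  by simp_all

lemma set_chain_left_subset: "x \<in> set (chain_left js a) \<Longrightarrow> x div 6 \<in> set js"
  by (auto simp: chain_left_def div_6 split: if_splits)

lemma set_chain_right_subset: "x \<in> set (chain_right js b) \<Longrightarrow> x div 6 \<in> set js"
  by (auto simp: chain_right_def div_6 split: if_splits)

text \<open>\<open>r\<close> is the cut. The pair \<open>6 * i\<close>, \<open>6 * i + 2\<close> is
  in order only if \<open>i \<in> a\<close>; otherwise every increasing pair ends in
  \<open>6 * i + 4\<close>.\<close>

lemma chain_left_block_le: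
  assumes "subseq w (chain_left [i] a)" "sorted_wrt (<) w" "\<forall>x\<in>set w. x \<le> 6 * i + r"
  shows "length w \<le> (if i \<in> a \<and> 2 \<le> r \<or> 4 \<le> r then 2 else 1)"
  using assms by (auto simp: chain_left_def Let_def simp flip: in_set_subseqs split: if_splits)

text \<open>Mirror image: an increasing pair can start at \<open>6 * i + 3\<close> only if
  \<open>i \<in> b\<close>; otherwise it starts at \<open>6 * i + 1\<close>.\<close>

lemma chain_right_block_le:
  assumes "subseq w (chain_right [i] b)" "sorted_wrt (<) w" "\<forall>x\<in>set w. 6 * i + r < x"
  shows "length w \<le> (if i \<in> b \<and> r \<le> 2 \<or> r = 0 then 2 else if r \<le> 4 then 1 else 0)"
  using assms by (auto simp: chain_right_def Let_def simp flip: in_set_subseqs split: if_splits)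

lemma chain_left_le:
  assumes "subseq w (chain_left js a)" "sorted_wrt (<) w"
  shows "length w \<le> 2 * length js"
  using assms
proof (induction js arbitrary: w)
  case (Cons i js)
  have "chain_left (i # js) a = chain_left [i] a @ chain_left js a"
    by (simp flip: chain_left_append)
  then obtain w1 w2 where w: "w = w1 @ w2" "subseq w1 (chain_left [i] a)" "subseq w2 (chain_left js a)"
    using Cons.prems(1) by (metis subseq_appendE)
  \<comment> \<open>The cut \<open>6\<close> lies beyond the block and so imposes nothing.\<close>
  have "x \<le> 6 * i + 6" if "x \<in> set w1" for x
  proof -
    have "x \<in> set (chain_left [i] a)" using that subseq_set_subset[OF w(2)] by (rule subsetD[rotated])
    then show ?thesis by (auto simp: chain_left_def split: if_splits)
  qed
  then have "length w1 \<le> 2"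
    using chain_left_block_le[OF w(2), of 6] Cons.prems(2) w(1) by (simp add: sorted_wrt_append)
  moreover have "length w2 \<le> 2 * length js"
    using Cons.IH[OF w(3)] Cons.prems(2) w(1) by (simp add: sorted_wrt_append)
  ultimately show ?case using w(1) by simp
qed simp

lemma chain_right_le:
  assumes "subseq w (chain_right js b)" "sorted_wrt (<) w"
  shows "length w \<le> 2 * length js"
  using assms
proof (induction js arbitrary: w)
  case (Cons i js)
  have "chain_right (i # js) b = chain_right [i] b @ chain_right js b"
    by (simp flip: chain_right_append)
  then obtain w1 w2 where w: "w = w1 @ w2" "subseq w1 (chain_right [i] b)" "subseq w2 (chain_right js b)"
    using Cons.prems(1) by (metis subseq_appendE)
  have "6 * i + 0 < x" if "x \<in> set w1" for x
  proof -
    have "x \<in> set (chain_right [i] b)" using that subseq_set_subset[OF w(2)] by (rule subsetD[rotated])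
    then show ?thesis by (auto simp: chain_right_def split: if_splits)
  qed
  then have "length w1 \<le> 2"
    using chain_right_block_le[OF w(2), of 0] Cons.prems(2) w(1) by (simp add: sorted_wrt_append)
  moreover have "length w2 \<le> 2 * length js"
    using Cons.IH[OF w(3)] Cons.prems(2) w(1) by (simp add: sorted_wrt_append)
  ultimately show ?case using w(1) by simp
qed simp

lemma upt_split_at: "i < t \<Longrightarrow> [0..<t] = [0..<i] @ [i] @ [Suc i..<t]"
  by (metis append_Cons append_Nil less_imp_le_nat upt_add_eq_append upt_conv_Cons le_add_diff_inverse zero_le)

lemma chain_left_split:
  "i < t \<Longrightarrow> chain_left [0..<t] a = chain_left [0..<i] a @ chain_left [i] a @ chain_left [Suc i..<t] a"
  by (simp only: upt_split_at chain_left_append)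

lemma chain_right_split:
  "i < t \<Longrightarrow> chain_right [0..<t] b = chain_right [0..<i] b @ chain_right [i] b @ chain_right [Suc i..<t] b"
  by (simp only: upt_split_at chain_right_append)

text \<open>The last element taken from the left word lies in some block \<open>i\<close>. Earlier
  blocks serve only the left word and later ones only the right word, with at most two elements
  each. If \<open>i\<close> is missing from \<open>a\<close> or \<open>b\<close>, no cut allows two
  elements from both sides, so block \<open>i\<close> yields at most three.\<close>

lemma chain_upper_bound:
  assumes "a \<inter> b = {}"
    and z: "subseq z (chain_left [0..<t] a @ chain_right [0..<t] b)" "sorted_wrt (<) z"
  shows "length z \<le> 2 * t + 1"
proof -
  from z(1) obtain u v where uv: "z = u @ v" "subseq u (chain_left [0..<t] a)" "subseq v (chain_right [0..<t] b)"
    by (rule subseq_appendE)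
  have sorted: "sorted_wrt (<) u" "sorted_wrt (<) v" "\<And>x y. x \<in> set u \<Longrightarrow> y \<in> set v \<Longrightarrow> x < y"
    using z(2) uv(1) by (auto simp: sorted_wrt_append)
  show ?thesis
  proof (cases "u = []")
    case True
    then show ?thesis using chain_right_le[OF uv(3) sorted(2)] uv(1) by simp
  next
    case False
    define m where "m = last u"
    define i where "i = m div 6"
    define r where "r = m mod 6"
    have m: "m = 6 * i + r" "r < 6" by (auto simp: i_def r_def)
    have "m \<in> set u" using False by (simp add: m_def)
    then have i: "i < t"
      using uv(2) subseq_set_subset set_chain_left_subset[of m "[0..<t]" a] by (auto simp: i_def)
    have u_le: "x \<le> 6 * i + r" if "x \<in> set u" for x
    proof -
      have "u = butlast u @ [m]" using False by (simp add: m_def)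
      then have "x < m \<or> x = m" using sorted(1) that
        by (metis in_set_conv_decomp_first in_set_butlast_appendI set_append UnE set_ConsD empty_iff empty_set list.set_intros(1) sorted_wrt_append)
      then show ?thesis using m by auto
    qed
    have v_gt: "6 * i + r < x" if "x \<in> set v" for x
      using sorted(3)[OF \<open>m \<in> set u\<close> that] m by simp
    have "subseq u (chain_left [0..<i] a @ chain_left [i] a @ chain_left [Suc i..<t] a)"
      using uv(2) chain_left_split[OF i] by simp
    then obtain u1 u2 u3 where u: "u = u1 @ u2 @ u3" "subseq u1 (chain_left [0..<i] a)"
      "subseq u2 (chain_left [i] a)" "subseq u3 (chain_left [Suc i..<t] a)"
      by (metis subseq_appendE)
    have "Suc i \<le> x div 6" if "x \<in> set u3" for x
      using u(4) that subseq_set_subset set_chain_left_subset[of x "[Suc i..<t]" a] by auto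
    then have "x \<notin> set u3" for x
      using u_le[of x] u(1) m(2) by fastforce
    then have "u3 = []" by (metis last_in_set)
    moreover have "length u1 \<le> 2 * i"
      using chain_left_le[OF u(2)] sorted(1) u(1) by (simp add: sorted_wrt_append)
    moreover have "length u2 \<le> (if i \<in> a \<and> 2 \<le> r \<or> 4 \<le> r then 2 else 1)"
      using u_le u(1) sorted(1) by (intro chain_left_block_le[OF u(3)]) (auto simp: sorted_wrt_append)
    ultimately have lu: "length u \<le> 2 * i + (if i \<in> a \<and> 2 \<le> r \<or> 4 \<le> r then 2 else 1)"
      using u(1) by simp
    have "subseq v (chain_right [0..<i] b @ chain_right [i] b @ chain_right [Suc i..<t] b)"
      using uv(3) chain_right_split[OF i] by simp
    then obtain v1 v2 v3 where v: "v = v1 @ v2 @ v3" "subseq v1 (chain_right [0..<i] b)"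
      "subseq v2 (chain_right [i] b)" "subseq v3 (chain_right [Suc i..<t] b)"
      by (metis subseq_appendE)
    have "x div 6 < i" if "x \<in> set v1" for x
      using v(2) that subseq_set_subset set_chain_right_subset[of x "[0..<i]" b] by auto
    then have "x \<notin> set v1" for x
      using v_gt[of x] v(1) m(2) by fastforce
    then have "v1 = []" by (metis last_in_set)
    moreover have "length v3 \<le> 2 * (t - Suc i)"
      using chain_right_le[OF v(4)] sorted(2) v(1) by (simp add: sorted_wrt_append)
    moreover have "length v2 \<le> (if i \<in> b \<and> r \<le> 2 \<or> r = 0 then 2 else if r \<le> 4 then 1 else 0)"
      using v_gt v(1) sorted(2) by (intro chain_right_block_le[OF v(3)]) (auto simp: sorted_wrt_append)
    ultimately have lv: "length v \<le> 2 * (t - Suc i) + (if i \<in> b \<and> r \<le> 2 \<or> r = 0 then 2 else if r \<le> 4 then 1 else 0)"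
      using v(1) by simp
    have "\<not> (i \<in> a \<and> i \<in> b)" using assms(1) by auto
    then show ?thesis
      using lu lv i uv(1) by (auto split: if_splits)
  qed
qed

lemma subseq_concat_map:
  "(\<And>j. j \<in> set js \<Longrightarrow> subseq (f j) (g j)) \<Longrightarrow> subseq (concat (map f js)) (concat (map g js))"
  by (induction js) (auto intro: list_emb_append_mono)

lemma sorted_concat_blocks:
  assumes "\<And>j. j \<in> set js \<Longrightarrow> sorted_wrt (<) (f j)" "\<And>j x. j \<in> set js \<Longrightarrow> x \<in> set (f j) \<Longrightarrow> x div 6 = j"
    "sorted_wrt (<) js"
  shows "sorted_wrt (<) (concat (map f js) :: nat list)"
  using assms
proof (induction js)
  case (Cons j js)
  have "x < y" if "x \<in> set (f j)" "j' \<in> set js" "y \<in> set (f j')" for x y j'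
  proof -
    have "x div 6 < y div 6" using Cons.prems that by force
    then show ?thesis using div_le_mono[of y x 6] by linarith
  qed
  then show ?case using Cons by (auto simp: sorted_wrt_append)
qed simp

lemma chain_lower_bound:
  assumes "i \<in> a" "i \<in> b" "i < t"
  obtains z where "subseq z (chain_left [0..<t] a @ chain_right [0..<t] b)" "subseq z [0..<6 * t]"
    "length z = 2 * t + 2"
proof
  \<comment> \<open>The pairs in \<open>?u\<close> and \<open>?v\<close> are in order whatever the
    bits are; at \<open>i\<close> both players contribute a pair, with the cut between
    \<open>6 * i + 2\<close> and \<open>6 * i + 3\<close>.\<close>
  let ?u = "concat (map (\<lambda>j. [6 * j, 6 * j + 4]) [0..<i])"
  let ?v = "concat (map (\<lambda>j. [6 * j + 1, 6 * j + 5]) [Suc i..<t])"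
  let ?z = "(?u @ [6 * i, 6 * i + 2]) @ ([6 * i + 3, 6 * i + 5] @ ?v)"
  have "subseq ?u (chain_left [0..<i] a)"
    unfolding chain_left_def by (rule subseq_concat_map) auto
  moreover have "subseq ([6 * i, 6 * i + 2] @ []) (chain_left [i] a @ chain_left [Suc i..<t] a)"
    using assms by (intro list_emb_append_mono) (auto simp: chain_left_def)
  ultimately have left: "subseq (?u @ [6 * i, 6 * i + 2]) (chain_left [0..<t] a)"
    unfolding chain_left_split[OF assms(3)] by (auto intro: list_emb_append_mono)
  have "subseq ?v (chain_right [Suc i..<t] b)"
    unfolding chain_right_def by (rule subseq_concat_map) auto
  moreover have "subseq ([6 * i + 3, 6 * i + 5]) (chain_right [i] b)"
    using assms by (auto simp: chain_right_def)
  ultimately have "subseq ([6 * i + 3, 6 * i + 5] @ ?v) (chain_right [i] b @ chain_right [Suc i..<t] b)"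
    by (intro list_emb_append_mono)
  then have right: "subseq ([6 * i + 3, 6 * i + 5] @ ?v) (chain_right [0..<t] b)"
    unfolding chain_right_split[OF assms(3)] by (auto intro: subseq_drop_many)
  show "subseq ?z (chain_left [0..<t] a @ chain_right [0..<t] b)"
    using left right by (rule list_emb_append_mono)
  have "sorted_wrt (<) ?u" "sorted_wrt (<) ?v"
    by (rule sorted_concat_blocks; auto)+
  then have "sorted_wrt (<) ?z"
    by (auto simp: sorted_wrt_append)
  then show "subseq ?z [0..<6 * t]"
    using assms(3) by (intro sorted_subset_imp_subseq) auto
  show "length ?z = 2 * t + 2"
    using assms(3) by (simp add: length_concat comp_def sum_list_triv)
qed

lemma lcs_chain:
  assumes "a \<subseteq> {..<t}"
  shows "2 * t + 2 \<le> lcs (chain_left [0..<t] a @ chain_right [0..<t] b) [0..<6 * t] \<longleftrightarrow> a \<inter> b \<noteq> {}"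
proof
  assume "2 * t + 2 \<le> lcs (chain_left [0..<t] a @ chain_right [0..<t] b) [0..<6 * t]"
  then obtain z where z: "subseq z (chain_left [0..<t] a @ chain_right [0..<t] b)"
    "subseq z [0..<6 * t]" "2 * t + 2 \<le> length z"
    using le_lcs_iff by blast
  have "sorted_wrt (<) z" using z(2) by (rule sorted_wrt_subseq) simp
  then show "a \<inter> b \<noteq> {}"
    using chain_upper_bound[OF _ z(1), of] z(3) by fastforce
next
  assume "a \<inter> b \<noteq> {}"
  then obtain i where "i \<in> a" "i \<in> b" "i < t" using assms by auto
  then show "2 * t + 2 \<le> lcs (chain_left [0..<t] a @ chain_right [0..<t] b) [0..<6 * t]"
    using chain_lower_bound length_le_lcs by metis
qed

lemma mset_chain: "mset (chain_left [0..<t] a @ chain_right [0..<t] b) = mset [0..<6 * t]"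
proof (induction t)
  case (Suc t)
  have "[0..<6 * Suc t] = [0..<6 * t] @ [6 * t, 6 * t + 1, 6 * t + 2, 6 * t + 3, 6 * t + 4, 6 * t + 5]"
    by (simp add: upt_rec[of "_ + _"] numeral_eq_Suc)
  moreover have "mset (chain_left [t] a) = {#6 * t, 6 * t + 2, 6 * t + 4#}"
    "mset (chain_right [t] b) = {#6 * t + 1, 6 * t + 3, 6 * t + 5#}"
    by (auto simp: chain_left_def chain_right_def)
  ultimately show ?case using Suc by (simp add: add_mset_commute)
qed simp

section \<open>Ballot words\<close>

text \<open>\<open>c\<close> holds the counts of the symbols read before. Larger symbols must never
  fall behind smaller ones; arbitrary initial counts make the condition compose under
  concatenation.\<close>

fun ballot :: "nat \<Rightarrow> (nat \<Rightarrow> nat) \<Rightarrow> nat list \<Rightarrow> bool" where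
  "ballot g c [] \<longleftrightarrow> mono_on {..<g} c"
| "ballot g c (v # x) \<longleftrightarrow> mono_on {..<g} c \<and> ballot g (c(v := Suc (c v))) x"

lemma ballot_mono_on: "ballot g c x \<Longrightarrow> mono_on {..<g} c"
  by (cases x) auto

lemma ballot_append:
  "ballot g c (x @ x') \<longleftrightarrow> ballot g c x \<and> ballot g (\<lambda>v. c v + count_list x v) x'"
proof (induction x arbitrary: c)
  case Nil
  then show ?case using ballot_mono_on by auto
next
  case (Cons v x)
  have "(\<lambda>w. (c(v := Suc (c v))) w + count_list x w) = (\<lambda>w. c w + count_list (v # x) w)"
    by auto
  then show ?case by (simp only: append_Cons ballot.simps Cons.IH conj_assoc)
qed

text \<open>Switching from \<open>v\<close> to a larger symbol never pays: after each letter the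
  larger symbol has been read at least as often, so the copies of \<open>v\<close> can be charged to
  copies of that symbol.\<close>

lemma ballot_sorted_subseq_le:
  assumes "ballot g c x" "set x \<subseteq> {..<g}" "subseq z x" "sorted z" "z \<noteq> []"
  shows "length z + c (hd z) \<le> c (last z) + count_list x (last z)"
  using assms
proof (induction x arbitrary: c z)
  case (Cons v x)
  let ?c = "c(v := Suc (c v))"
  have IH: "length z + ?c (hd z) \<le> ?c (last z) + count_list x (last z)"
    if "subseq z x" "sorted z" "z \<noteq> []" for z
    using Cons.IH[of ?c z] Cons.prems(1,2) that by (simp del: fun_upd_apply)
  have upd: "?c w + count_list x w = c w + count_list (v # x) w" for w
    by simp
  show ?case
  proof (cases "subseq z x")
    case True
    then have "length z + ?c (hd z) \<le> c (last z) + count_list (v # x) (last z)"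
      using IH[of z] Cons.prems(4,5) upd by metis
    then show ?thesis by (auto split: if_splits)
  next
    case False
    then obtain z' where z: "z = v # z'" "subseq z' x"
      using Cons.prems(3,5) by (cases z) (auto split: if_splits)
    show ?thesis
    proof (cases "z' = []")
      case False
      then have "length z' + ?c (hd z') \<le> c (last z) + count_list (v # x) (last z)"
        using IH[of z'] Cons.prems(4) z upd by (metis last_ConsR sorted_simps(2))
      moreover have "?c v \<le> ?c (hd z')"
      proof -
        have "hd z' \<in> set x" using subseq_set_subset[OF z(2)] hd_in_set[OF False] by (rule subsetD)
        then have "v \<in> {..<g}" "hd z' \<in> {..<g}" using Cons.prems(2) by (auto dest: subsetD)
        moreover have "v \<le> hd z'" using False z(1) Cons.prems(4) by simp
        moreover have "mono_on {..<g} ?c"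
          using Cons.prems(1) by (intro ballot_mono_on[of g ?c x]) simp
        ultimately show ?thesis by (intro mono_onD[of "{..<g}" ?c v "hd z'"])
      qed
      ultimately show ?thesis using z(1) by simp
    qed (use z in simp)
  qed
qed simp

lemma lcs_ballot_le:
  assumes "ballot g (\<lambda>_. 0) x" "set x \<subseteq> {..<g}" "\<And>v. v < g \<Longrightarrow> count_list x v \<le> h" "sorted y"
  shows "lcs x y \<le> h"
proof -
  obtain z where z: "subseq z x" "subseq z y" "lcs x y \<le> length z"
    using le_lcs_iff by blast
  show ?thesis
  proof (cases "z = []")
    case False
    have "sorted z" using z(2) assms(4) by (rule sorted_wrt_subseq)
    then have "length z \<le> count_list x (last z)"
      using ballot_sorted_subseq_le[OF assms(1,2) z(1) _ False] by simp
    moreover have "last z < g"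
      using False z(1) assms(2) subseq_set_subset last_in_set by blast
    ultimately show ?thesis using assms(3)[of "last z"] z(3) by linarith
  qed (use z in simp)
qed

definition blocks :: "nat \<Rightarrow> nat \<Rightarrow> nat list" where
  "blocks g h = concat (map (replicate h) [0..<g])"

lemma sorted_blocks: "sorted (blocks g h)"
  unfolding blocks_def by (induction g) (auto simp: sorted_append)

lemma count_list_blocks: "count_list (blocks g h) v = (if v < g then h else 0)"
proof -
  have "count_list (replicate h w) v = (if v = w then h else 0)" for w
    by (induction h) auto
  then show ?thesis
    unfolding blocks_def by (induction g) auto
qed

text \<open>Take every \<open>v\<close> in \<open>x1\<close> and then every \<open>w\<close> in
  \<open>x2\<close>: this exceeds \<open>h\<close> by the difference of the two counts in
  \<open>x1\<close>.\<close>

lemma lcs_blocks_gt: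
  assumes "x = x1 @ x2" "\<And>v. v < g \<Longrightarrow> count_list x v = h" "v < w" "w < g"
    and "count_list x1 w < count_list x1 v"
  shows "h + 1 \<le> lcs x (blocks g h)"
proof -
  let ?z = "replicate (count_list x1 v) v @ replicate (count_list x2 w) w"
  have le: "count_list x1 v \<le> h" "count_list x1 w + count_list x2 w = h"
    using assms(1,3,4) assms(2)[of v] assms(2)[of w] by auto
  have "subseq ?z x"
    unfolding assms(1) using subseq_replicate_count[of x1 v] subseq_replicate_count[of x2 w]
    by (intro list_emb_append_mono) (simp_all add: count_mset)
  moreover have "subseq ?z (blocks g h)"
  proof -
    have repl: "subseq (replicate m u) (replicate h u)" if "m \<le> h" for m and u :: nat
      using that by (metis le_add_diff_inverse replicate_add subseq_rev_drop_many subseq_order.order_refl)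
    have "[0..<g] = [0..<v] @ [v] @ [Suc v..<g]"
      using assms(3,4) by (intro upt_split_at) simp
    moreover have "[Suc v..<g] = [Suc v..<w] @ [w] @ [Suc w..<g]"
      using assms(3,4) by (metis append_Cons append_Nil less_imp_le_nat le_add_diff_inverse
          upt_add_eq_append upt_conv_Cons Suc_leI)
    ultimately have "blocks g h = (blocks v h @ replicate h v) @
        (concat (map (replicate h) [Suc v..<w]) @ replicate h w @ concat (map (replicate h) [Suc w..<g]))"
      by (simp add: blocks_def)
    moreover have "subseq (replicate (count_list x1 v) v) (blocks v h @ replicate h v)"
      using le repl subseq_drop_many by metis
    moreover have "subseq (replicate (count_list x2 w) w)
        (concat (map (replicate h) [Suc v..<w]) @ replicate h w @ concat (map (replicate h) [Suc w..<g]))"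
      using le repl subseq_drop_many subseq_rev_drop_many by (metis le_add2)
    ultimately show ?thesis by (simp only: list_emb_append_mono)
  qed
  moreover have "h + 1 \<le> length ?z"
    using le assms(5) by simp
  ultimately show ?thesis
    using le_lcs_iff by blast
qed

section \<open>Ballot words encoding disjointness\<close>

definition fill :: "nat \<Rightarrow> (nat \<Rightarrow> nat) \<Rightarrow> (nat \<Rightarrow> nat) \<Rightarrow> nat list" where
  "fill m c d = concat (map (\<lambda>v. replicate (d v - c v) v) (rev [0..<m]))"

lemma fill_Suc: "fill (Suc m) c d = replicate (d m - c m) m @ fill m c d"
  by (simp add: fill_def)

lemma count_list_fill: "count_list (fill m c d) v = (if v < m then d v - c v else 0)"
proof -
  have "count_list (replicate n w) v = (if v = w then n else 0)" for n w
    by (induction n) auto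
  then show ?thesis
    by (induction m) (auto simp: fill_def less_Suc_eq)
qed

lemma length_fill: "length (fill m c d) = (\<Sum>v<m. d v - c v)"
  by (induction m) (auto simp: fill_def)

lemma set_fill_subset: "set (fill m c d) \<subseteq> {..<m}"
  by (auto simp: fill_def)

lemma ballot_replicate:
  assumes "\<And>e. e \<le> d \<Longrightarrow> mono_on {..<g} (c(v := c v + e))"
  shows "ballot g c (replicate d v)"
  using assms
proof (induction d arbitrary: c)
  case 0
  then show ?case using 0[of 0] by simp
next
  case (Suc d)
  have "(c(v := Suc (c v)))(v := (c(v := Suc (c v))) v + e) = c(v := c v + Suc e)" for e
    by auto
  then have "mono_on {..<g} ((c(v := Suc (c v)))(v := (c(v := Suc (c v))) v + e))" if "e \<le> d" for e
    using Suc.prems[of "Suc e"] that by (simp only: Suc_le_mono)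
  then have "ballot g (c(v := Suc (c v))) (replicate d v)"
    by (rule Suc.IH)
  then show ?case using Suc.prems[of 0] by simp
qed

text \<open>Symbols are raised from the largest downwards. The vector \<open>s\<close> describes the
  moment when those from \<open>m\<close> on have reached \<open>d\<close> and the smaller ones are
  still at \<open>c\<close>; it is monotone because \<open>c\<close> and \<open>d\<close> are and
  \<open>c\<close> lies below \<open>d\<close>.\<close>

lemma ballot_fill:
  assumes mono: "mono_on {..<g} c" "mono_on {..<g} d" and le: "\<And>v. v < g \<Longrightarrow> c v \<le> d v"
    and "m \<le> g" "\<And>v. v < g \<Longrightarrow> s v = (if v < m then c v else d v)"
  shows "ballot g s (fill m c d)"
  using assms(4,5)
proof (induction m arbitrary: s)
  case 0
  then have "mono_on {..<g} s" using mono(2) by (auto simp: mono_on_def)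
  then show ?case by (simp add: fill_def)
next
  case (Suc m)
  have "ballot g s (replicate (d m - c m) m)"
  proof (rule ballot_replicate, rule mono_onI)
    fix e u v assume e: "e \<le> d m - c m" and uv: "u \<in> {..<g}" "v \<in> {..<g}" "u \<le> v"
    have "c u \<le> c v" "d u \<le> d v" using mono_onD[OF mono(1) uv] mono_onD[OF mono(2) uv] by auto
    moreover have "c u \<le> d u" "c v \<le> d v" "c m \<le> d m" using le uv Suc.prems(1) by auto
    moreover have "c u \<le> c m" if "u \<le> m" using mono_onD[OF mono(1) uv(1), of m] that Suc.prems(1) by simp
    moreover have "d m \<le> d v" if "m \<le> v" using mono_onD[OF mono(2) _ uv(2), of m] that Suc.prems(1) by simp
    ultimately show "(s(m := s m + e)) u \<le> (s(m := s m + e)) v"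
      using e uv Suc.prems by (auto simp: le_diff_conv2)
  qed
  moreover have "ballot g (\<lambda>v. s v + count_list (replicate (d m - c m) m) v) (fill m c d)"
  proof (rule Suc.IH)
    have "count_list (replicate n m) v = (if v = m then n else 0)" for n v
      by (induction n) auto
    then show "s v + count_list (replicate (d m - c m) m) v = (if v < m then c v else d v)" if "v < g" for v
      using Suc.prems(2)[OF that] le[OF that] by auto
  qed (use Suc.prems in simp)
  ultimately show ?case by (simp add: fill_Suc ballot_append)
qed

text \<open>Symbol \<open>3 * j\<close> is level with \<open>3 * j + 1\<close> if \<open>j \<in> a\<close> and one below otherwise, so reading \<open>3 * j\<close>
  first violates the ballot condition iff \<open>j \<in> a\<close>. Symbol \<open>3 * j + 2\<close> only makes the length
  independent of \<open>a\<close>.\<close>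

definition ballot_level :: "nat set \<Rightarrow> nat \<Rightarrow> nat" where
  "ballot_level a v = v + of_bool (v mod 3 = 0 \<and> v div 3 \<in> a \<or> v mod 3 = 2 \<and> v div 3 \<notin> a)"

text \<open>Only the order within a pair depends on \<open>b\<close>. The counts afterwards do not,
  so the closing segment can be written knowing \<open>a\<close> alone.\<close>

definition ballot_middle :: "nat \<Rightarrow> nat set \<Rightarrow> nat list" where
  "ballot_middle t b = concat (map (\<lambda>j. if j \<in> b then [3 * j, 3 * j + 1] else [3 * j + 1, 3 * j]) [0..<t])"

definition ballot_word :: "nat \<Rightarrow> nat \<Rightarrow> nat set \<Rightarrow> nat set \<Rightarrow> nat list" where
  "ballot_word t h a b = fill (3 * t) (\<lambda>_. 0) (ballot_level a) @ ballot_middle t b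
     @ fill (3 * t) (\<lambda>v. ballot_level a v + of_bool (v mod 3 \<noteq> 2)) (\<lambda>_. h)"

text \<open>Consecutive levels differ by at least one except from \<open>3 * j\<close> to
  \<open>3 * j + 1\<close> when \<open>j \<in> a\<close>, and possibly from \<open>3 * j + 2\<close>
  to the next symbol. The last two assumptions on \<open>e\<close> cover these places.\<close>

lemma mono_ballot_level_add:
  assumes "\<And>j. e (3 * j) \<le> 1" "\<And>j. e (3 * j + 1) \<le> 1" "\<And>j. e (3 * j + 2) = 0"
    "\<And>j. j \<in> a \<Longrightarrow> e (3 * j) \<le> e (3 * j + 1)"
  shows "mono_on {..<g} (\<lambda>v. ballot_level a v + e v)"
proof -
  have "ballot_level a v + e v \<le> ballot_level a (Suc v) + e (Suc v)" for v
  proof -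
    define j where "j = v div 3"
    have dm: "(3 * j) div 3 = j" "(3 * j) mod 3 = 0" "(3 * j + 1) div 3 = j" "(3 * j + 1) mod 3 = 1"
      "(3 * j + 2) div 3 = j" "(3 * j + 2) mod 3 = 2" "(3 * Suc j) div 3 = Suc j" "(3 * Suc j) mod 3 = 0" for j
      by simp_all presburger+
    consider "v = 3 * j" "Suc v = 3 * j + 1" | "v = 3 * j + 1" "Suc v = 3 * j + 2" | "v = 3 * j + 2" "Suc v = 3 * Suc j"
      unfolding j_def by atomize_elim presburger
    then show ?thesis
    proof cases
      case 1
      show ?thesis unfolding 1 ballot_level_def dm using assms(1,4)[of j] by auto
    next
      case 2
      show ?thesis unfolding 2 ballot_level_def dm using assms(2,3)[of j] by auto
    next
      case 3
      show ?thesis unfolding 3 ballot_level_def dm using assms(3)[of j] by auto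
    qed
  qed
  then have "mono (\<lambda>v. ballot_level a v + e v)" by (simp add: mono_iff_le_Suc)
  then show ?thesis by (rule mono_on_subset) simp
qed

lemma count_list_ballot_middle:
  "count_list (ballot_middle t b) v = of_bool (v < 3 * t \<and> v mod 3 \<noteq> 2)"
proof (induction t)
  case (Suc t)
  have "ballot_middle (Suc t) b = ballot_middle t b @ (if t \<in> b then [3 * t, 3 * t + 1] else [3 * t + 1, 3 * t])"
    by (simp add: ballot_middle_def)
  moreover have "v = 3 * t \<or> v = 3 * t + 1 \<longleftrightarrow> 3 * t \<le> v \<and> v < 3 * Suc t \<and> v mod 3 \<noteq> 2"
    by presburger
  ultimately show ?case using Suc by auto
qed (simp add: ballot_middle_def)

lemma ballot_ballot_middle:
  assumes "a \<inter> b = {}" "\<And>v. v < g \<Longrightarrow> s v = ballot_level a v"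
  shows "ballot g s (ballot_middle t b)"
proof (induction t)
  case 0
  have "mono_on {..<g} (\<lambda>v. ballot_level a v + (\<lambda>_. 0) v)" by (rule mono_ballot_level_add) auto
  then have "mono_on {..<g} s" using assms(2) by (auto simp: mono_on_def)
  then show ?case by (simp add: ballot_middle_def)
next
  case (Suc t)
  let ?B = "if t \<in> b then [3 * t, 3 * t + 1] else [3 * t + 1, 3 * t]"
  let ?s = "\<lambda>v. s v + count_list (ballot_middle t b) v"
  \<comment> \<open>Common form of all vectors met in this round: the earlier pairs are complete,
    and \<open>e\<close> records what has been read of the current one.\<close>
  have mono: "mono_on {..<g} s'"
    if "\<And>v. v < g \<Longrightarrow> s' v = ballot_level a v + (of_bool (v < 3 * t \<and> v mod 3 \<noteq> 2) + e v)"
      "\<And>v. e v \<le> of_bool (v = 3 * t \<or> v = 3 * t + 1)" "t \<in> a \<Longrightarrow> e (3 * t) \<le> e (3 * t + 1)" for s' e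
  proof -
    have "mono_on {..<g} (\<lambda>v. ballot_level a v + (\<lambda>v. of_bool (v < 3 * t \<and> v mod 3 \<noteq> 2) + e v) v)"
    proof (rule mono_ballot_level_add)
      fix j
      show "of_bool (3 * j < 3 * t \<and> 3 * j mod 3 \<noteq> 2) + e (3 * j) \<le> 1"
        using that(2)[of "3 * j"] by (cases "j = t") auto
      show "of_bool (3 * j + 1 < 3 * t \<and> (3 * j + 1) mod 3 \<noteq> 2) + e (3 * j + 1) \<le> 1"
        using that(2)[of "3 * j + 1"] by (cases "j = t") auto
      have "3 * j + 2 \<noteq> 3 * t" "3 * j + 2 \<noteq> 3 * t + 1" "(3 * j + 2) mod 3 = 2" by presburger+
      then show "of_bool (3 * j + 2 < 3 * t \<and> (3 * j + 2) mod 3 \<noteq> 2) + e (3 * j + 2) = 0"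
        using that(2)[of "3 * j + 2"] by simp
      show "of_bool (3 * j < 3 * t \<and> 3 * j mod 3 \<noteq> 2) + e (3 * j)
          \<le> of_bool (3 * j + 1 < 3 * t \<and> (3 * j + 1) mod 3 \<noteq> 2) + e (3 * j + 1)" if "j \<in> a"
      proof (cases "j = t")
        case True
        then show ?thesis using \<open>t \<in> a \<Longrightarrow> e (3 * t) \<le> e (3 * t + 1)\<close> that by simp
      next
        case False
        then have "e (3 * j) = 0" using \<open>\<And>v. e v \<le> of_bool (v = 3 * t \<or> v = 3 * t + 1)\<close>[of "3 * j"] by simp
        moreover have "(3 * j + 1) mod 3 \<noteq> 2" by presburger
        ultimately show ?thesis by auto
      qed
    qed
    then show ?thesis using that(1) by (auto simp: mono_on_def)
  qed
  have eq: "?s v = ballot_level a v + of_bool (v < 3 * t \<and> v mod 3 \<noteq> 2)" if "v < g" for v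
    using assms(2)[OF that] by (simp add: count_list_ballot_middle)
  have m0: "mono_on {..<g} ?s"
    by (rule mono[where e = "\<lambda>_. 0"]) (use eq in auto)
  \<comment> \<open>Only here does \<open>a\<close> matter: \<open>3 * t\<close> may be read first
    because it is one below \<open>3 * t + 1\<close>.\<close>
  have m1: "mono_on {..<g} (?s(3 * t := Suc (?s (3 * t))))" if "t \<notin> a"
    by (rule mono[where e = "\<lambda>v. of_bool (v = 3 * t)"]) (use eq that in auto)
  have m2: "mono_on {..<g} (?s(3 * t + 1 := Suc (?s (3 * t + 1))))"
    by (rule mono[where e = "\<lambda>v. of_bool (v = 3 * t + 1)"]) (use eq in auto)
  have m3: "mono_on {..<g} (?s(3 * t := Suc (?s (3 * t)), 3 * t + 1 := Suc (?s (3 * t + 1))))"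
    by (rule mono[where e = "\<lambda>v. of_bool (v = 3 * t \<or> v = 3 * t + 1)"]) (use eq in auto)
  have "ballot g ?s ?B"
  proof (cases "t \<in> b")
    case True
    then have "t \<notin> a" using assms(1) by auto
    then show ?thesis using m0 m1 m3 True by simp
  next
    case False
    then show ?thesis using m0 m2 m3 by (simp add: fun_upd_twist)
  qed
  moreover have "ballot_middle (Suc t) b = ballot_middle t b @ ?B"
    by (simp add: ballot_middle_def)
  ultimately show ?case using Suc by (simp add: ballot_append)
qed

text \<open>Makes the truncated subtraction in the closing \<open>fill\<close> exact once
  \<open>3 * t \<le> h\<close>.\<close>

lemma ballot_level_le:
  assumes "v < 3 * t"
  shows "ballot_level a v + of_bool (v mod 3 \<noteq> 2) \<le> 3 * t"
proof -
  have "v + 2 \<le> 3 * t \<or> v mod 3 = 2" using assms by presburger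
  then show ?thesis using assms by (auto simp: ballot_level_def)
qed

lemma count_list_ballot_word:
  assumes "3 * t \<le> h"
  shows "count_list (ballot_word t h a b) v = (if v < 3 * t then h else 0)"
proof (cases "v < 3 * t")
  case True
  then show ?thesis
    using ballot_level_le[of v t a] assms
    by (simp add: ballot_word_def count_list_fill count_list_ballot_middle)
qed (simp add: ballot_word_def count_list_fill count_list_ballot_middle)

lemma set_ballot_word_subset: "set (ballot_word t h a b) \<subseteq> {..<3 * t}"
proof -
  have "set (ballot_middle t b) \<subseteq> {..<3 * t}" by (auto simp: ballot_middle_def split: if_splits)
  then show ?thesis using set_fill_subset by (auto simp: ballot_word_def dest: subsetD)
qed

lemma ballot_ballot_word:
  assumes "3 * t \<le> h" "a \<inter> b = {}"
  shows "ballot (3 * t) (\<lambda>_. 0) (ballot_word t h a b)"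
proof -
  have level: "mono_on {..<3 * t} (ballot_level a)"
    using mono_ballot_level_add[of "\<lambda>_. 0" a "3 * t"] by simp
  have m3: "(3 * j) mod 3 = 0" "(3 * j + 1) mod 3 = 1" "(3 * j + 2) mod 3 = 2" "Suc (Suc (3 * j)) mod 3 = 2" for j :: nat
    by presburger+
  have level': "mono_on {..<3 * t} (\<lambda>v. ballot_level a v + of_bool (v mod 3 \<noteq> 2))"
    by (rule mono_ballot_level_add) (simp_all add: m3)
  have const: "mono_on {..<3 * t} (\<lambda>_. n :: nat)" for n by (rule mono_onI) simp
  have "ballot (3 * t) (\<lambda>_. 0) (fill (3 * t) (\<lambda>_. 0) (ballot_level a))"
    by (rule ballot_fill) (simp_all add: level const)
  moreover have "ballot (3 * t) (\<lambda>v. 0 + count_list (fill (3 * t) (\<lambda>_. 0) (ballot_level a)) v) (ballot_middle t b)"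
    by (rule ballot_ballot_middle[OF assms(2)]) (simp add: count_list_fill)
  moreover have "ballot (3 * t) (\<lambda>v. 0 + count_list (fill (3 * t) (\<lambda>_. 0) (ballot_level a)) v + count_list (ballot_middle t b) v)
      (fill (3 * t) (\<lambda>v. ballot_level a v + of_bool (v mod 3 \<noteq> 2)) (\<lambda>_. h))"
  proof (rule ballot_fill)
    show "ballot_level a v + of_bool (v mod 3 \<noteq> 2) \<le> h" if "v < 3 * t" for v
      using ballot_level_le[OF that, of a] assms(1) by simp
  qed (simp_all add: level' const count_list_fill count_list_ballot_middle)
  ultimately show ?thesis by (simp add: ballot_word_def ballot_append)
qed

lemma lcs_ballot_word:
  assumes "3 * t \<le> h" "a \<subseteq> {..<t}"
  shows "h + 1 \<le> lcs (ballot_word t h a b) (blocks (3 * t) h) \<longleftrightarrow> a \<inter> b \<noteq> {}"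
proof
  assume "h + 1 \<le> lcs (ballot_word t h a b) (blocks (3 * t) h)"
  moreover have "lcs (ballot_word t h a b) (blocks (3 * t) h) \<le> h" if "a \<inter> b = {}"
    using assms(1) that set_ballot_word_subset
    by (intro lcs_ballot_le[OF ballot_ballot_word]) (auto simp: count_list_ballot_word sorted_blocks)
  ultimately show "a \<inter> b \<noteq> {}" by fastforce
next
  assume "a \<inter> b \<noteq> {}"
  then obtain j where j: "j \<in> a" "j \<in> b" "j < t" using assms(2) by auto
  \<comment> \<open>The cut falls between the two symbols of pair \<open>j\<close>. They were level
    since \<open>j \<in> a\<close>, so \<open>3 * j\<close> is now one ahead.\<close>
  define x1 where "x1 = fill (3 * t) (\<lambda>_. 0) (ballot_level a) @ ballot_middle j b @ [3 * j]"
  define x2 where "x2 = [3 * j + 1] @ concat (map (\<lambda>j. if j \<in> b then [3 * j, 3 * j + 1] else [3 * j + 1, 3 * j]) [Suc j..<t])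
     @ fill (3 * t) (\<lambda>v. ballot_level a v + of_bool (v mod 3 \<noteq> 2)) (\<lambda>_. h)"
  have "ballot_word t h a b = x1 @ x2"
    using j(2) unfolding ballot_word_def x1_def x2_def ballot_middle_def upt_split_at[OF j(3)] by simp
  moreover have "count_list x1 (3 * j + 1) < count_list x1 (3 * j)"
  proof -
    have "(3 * j + 1) mod 3 = 1" by presburger
    then show ?thesis
      using j by (simp add: x1_def count_list_fill count_list_ballot_middle ballot_level_def)
  qed
  moreover have "count_list (ballot_word t h a b) v = h" if "v < 3 * t" for v
    using that by (simp add: count_list_ballot_word[OF assms(1)])
  ultimately show "h + 1 \<le> lcs (ballot_word t h a b) (blocks (3 * t) h)"
    using j(3) by (intro lcs_blocks_gt[of _ x1 x2 "3 * t" h "3 * j" "3 * j + 1"]) auto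
qed

lemma mset_ballot_word:
  assumes "3 * t \<le> h"
  shows "mset (ballot_word t h a b) = mset (blocks (3 * t) h)"
  by (rule multiset_eqI) (simp add: count_mset count_list_ballot_word[OF assms] count_list_blocks)

lemma length_ballot_middle [simp]: "length (ballot_middle t b) = 2 * t"
  by (induction t) (auto simp: ballot_middle_def)

lemma length_fill_ballot_level:
  "length (fill (3 * t) (\<lambda>_. 0) (ballot_level a)) = (\<Sum>j<t. 9 * j + 4)"
proof -
  have "(\<Sum>v<3 * t. ballot_level a v) = (\<Sum>j<t. 9 * j + 4)"
  proof (induction t)
    case (Suc t)
    have "(3 * t + 1) div 3 = t" "(3 * t + 1) mod 3 = 1" "(3 * t + 2) div 3 = t" "(3 * t + 2) mod 3 = 2"
      by presburger+
    then have "ballot_level a (3 * t) + ballot_level a (3 * t + 1) + ballot_level a (3 * t + 2) = 9 * t + 4"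
      by (auto simp: ballot_level_def)
    moreover have "{..<3 * Suc t} = {..<Suc (Suc (Suc (3 * t)))}" by auto
    ultimately show ?case using Suc by (simp add: lessThan_Suc)
  qed simp
  then show ?thesis by (simp add: length_fill)
qed

section \<open>Embeddings of disjointness\<close>

lemma disjointness_embedding_map:
  assumes "disjointness_embedding t k I p q p' y l l'" "inj_on e S"
    and "\<And>x y. (x, y) \<in> I \<Longrightarrow> set x \<subseteq> S \<and> set y \<subseteq> S \<and> (map e x, map e y) \<in> J"
  shows "disjointness_embedding t k J (map e \<circ> p) (map e \<circ> q) (map e \<circ> p') (map e y) l l'"
proof -
  have "(map e (p a @ q b @ p' a), map e y) \<in> J \<and>
      (k \<le> lcs (map e (p a @ q b @ p' a)) (map e y) \<longleftrightarrow> a \<inter> b \<noteq> {})"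
    if "a \<subseteq> {..<t}" "b \<subseteq> {..<t}" for a b
  proof -
    have I: "(p a @ q b @ p' a, y) \<in> I" and "k \<le> lcs (p a @ q b @ p' a) y \<longleftrightarrow> a \<inter> b \<noteq> {}"
      using assms(1) that by (auto simp: disjointness_embedding_def)
    moreover have "lcs (map e (p a @ q b @ p' a)) (map e y) = lcs (p a @ q b @ p' a) y"
      using assms(3)[OF I] by (intro lcs_map[OF assms(2)]) auto
    ultimately show ?thesis using assms(3)[OF I] by simp
  qed
  then show ?thesis
    using assms(1) by (simp add: disjointness_embedding_def)
qed

lemma disjointness_embedding_common_prefix:
  assumes "disjointness_embedding t k I p q p' y l l'"
    and "\<And>x y. (x, y) \<in> I \<Longrightarrow> (r @ x, r @ y) \<in> J"
  shows "disjointness_embedding t (k + length r) J (\<lambda>a. r @ p a) q p' (r @ y) (length r + l) l'"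
  using assms by (simp add: disjointness_embedding_def le_lcs_common_prefix)

lemma disjointness_embedding_crossing:
  assumes "disjointness_embedding t k I p q p' y l l'" "lcs F F' < k"
    and I: "\<And>x y. (x, y) \<in> I \<Longrightarrow> set F \<inter> set y = {} \<and> set F' \<inter> set x = {} \<and> (F @ x, y @ F') \<in> J"
  shows "disjointness_embedding t k J (\<lambda>a. F @ p a) q p' (y @ F') (length F + l) l'"
proof -
  have "(F @ p a @ q b @ p' a, y @ F') \<in> J \<and>
      (k \<le> lcs (F @ p a @ q b @ p' a) (y @ F') \<longleftrightarrow> a \<inter> b \<noteq> {})"
    if "a \<subseteq> {..<t}" "b \<subseteq> {..<t}" for a b
  proof -
    have xy: "(p a @ q b @ p' a, y) \<in> I" and "k \<le> lcs (p a @ q b @ p' a) y \<longleftrightarrow> a \<inter> b \<noteq> {}"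
      using assms(1) that by (auto simp: disjointness_embedding_def)
    then show ?thesis
      using I[OF xy] le_lcs_crossing[OF _ _ assms(2), of y "p a @ q b @ p' a"] by blast
  qed
  then show ?thesis
    using assms(1) by (simp add: disjointness_embedding_def)
qed

section \<open>Instances of prescribed length and alphabet\<close>

definition embeds_disjointness :: "nat \<Rightarrow> nat \<Rightarrow> ('a list \<times> 'a list) set \<Rightarrow> bool" where
  "embeds_disjointness t k I \<longleftrightarrow> (\<exists>p q p' y l l'. disjointness_embedding t k I p q p' y l l')"

lemma mem_perm_pairs:
  "(x, y) \<in> perm_pairs S n \<longleftrightarrow> set x \<subseteq> S \<and> length x = n \<and> mset x = mset y"
  by (auto simp: perm_pairs_def string_pairs_def lists_eq_set dest: mset_eq_setD mset_eq_length)

lemma embeds_disjointness_chain: "embeds_disjointness t (2 * t + 2) (perm_pairs {..<6 * t} (6 * t))"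
proof -
  have "(chain_left [0..<t] a @ chain_right [0..<t] b @ [], [0..<6 * t]) \<in> perm_pairs {..<6 * t} (6 * t)" for a b
    using mset_chain[of t a b] mset_eq_setD[OF mset_chain[of t a b]]
    by (auto simp: mem_perm_pairs simp del: mset_upt set_append)
  then have "disjointness_embedding t (2 * t + 2) (perm_pairs {..<6 * t} (6 * t)) (chain_left [0..<t])
      (chain_right [0..<t]) (\<lambda>_. []) [0..<6 * t] (3 * t) (3 * t)"
    using lcs_chain by (simp add: disjointness_embedding_def)
  then show ?thesis
    unfolding embeds_disjointness_def by blast
qed

lemma embeds_disjointness_ballot:
  assumes "3 * t \<le> h"
  shows "embeds_disjointness t (h + 1) (perm_pairs {..<3 * t} (3 * t * h))"
proof -
  have "length (ballot_word t h a b) = 3 * t * h" for a b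
    using mset_eq_length[OF mset_ballot_word[OF assms, of a b]]
    by (simp add: blocks_def length_concat comp_def sum_list_triv)
  then have "(ballot_word t h a b, blocks (3 * t) h) \<in> perm_pairs {..<3 * t} (3 * t * h)" for a b
    using mset_ballot_word[OF assms] set_ballot_word_subset by (simp add: mem_perm_pairs)
  then have "disjointness_embedding t (h + 1) (perm_pairs {..<3 * t} (3 * t * h))
      (\<lambda>a. fill (3 * t) (\<lambda>_. 0) (ballot_level a)) (ballot_middle t)
      (\<lambda>a. fill (3 * t) (\<lambda>v. ballot_level a v + of_bool (v mod 3 \<noteq> 2)) (\<lambda>_. h))
      (blocks (3 * t) h) (\<Sum>j<t. 9 * j + 4) (2 * t)"
    using lcs_ballot_word[OF assms]
    by (simp add: disjointness_embedding_def length_fill_ballot_level flip: ballot_word_def)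
  then show ?thesis
    unfolding embeds_disjointness_def by blast
qed

text \<open>The filler \<open>F\<close> lists new symbols in increasing order, each at most
  \<open>k - 1\<close> times. It precedes the stream and, reversed, follows the second string, so
  \<open>lcs F (rev F) < k\<close> and the crossing lemma applies.\<close>

lemma embeds_disjointness_filler:
  assumes emb: "embeds_disjointness t k (perm_pairs {..<g} n\<^sub>0)" and k: "2 \<le> k"
    and n: "n\<^sub>0 \<le> n" "n \<le> n\<^sub>0 + (k - 1) * (m - g)" and g: "g \<le> m"
  shows "embeds_disjointness t k (perm_pairs {..<m} n)"
proof -
  define F where "F = map (\<lambda>i. g + i div (k - 1)) [0..<n - n\<^sub>0]"
  have len: "length F = n - n\<^sub>0" by (simp add: F_def)
  have "sorted F"
    unfolding F_def by (auto simp: sorted_iff_nth_mono intro!: div_le_mono)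
  moreover have "count_list F v \<le> k - 1" for v
  proof -
    have "count_list F v = length (filter (\<lambda>i. v = g + i div (k - 1)) [0..<n - n\<^sub>0])"
      by (simp add: F_def count_list_eq_length_filter filter_map comp_def)
    also have "\<dots> = card {i. i < n - n\<^sub>0 \<and> g + i div (k - 1) = v}"
      by (subst length_filter_conv_card) (auto intro!: arg_cong[where f = card])
    also have "\<dots> \<le> card {(k - 1) * (v - g)..<(k - 1) * (v - g) + (k - 1)}"
    proof (intro card_mono subsetI)
      fix i assume "i \<in> {i. i < n - n\<^sub>0 \<and> g + i div (k - 1) = v}"
      then have "i div (k - 1) = v - g" by auto
      moreover have "(k - 1) * (i div (k - 1)) \<le> i" "i < (k - 1) * (i div (k - 1)) + (k - 1)"
        using k mod_less_divisor[of "k - 1" i] mult_div_mod_eq[of "k - 1" i] by linarith+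
      ultimately show "i \<in> {(k - 1) * (v - g)..<(k - 1) * (v - g) + (k - 1)}"
        by (simp only: atLeastLessThan_iff)
    qed simp
    finally show ?thesis by simp
  qed
  ultimately have "lcs F (rev F) \<le> k - 1" by (rule lcs_sorted_rev_le)
  then have lcs: "lcs F (rev F) < k" using k by simp
  have setF: "set F \<subseteq> {g..<m}"
  proof -
    have "g + i div (k - 1) < m" if "i < n - n\<^sub>0" for i
    proof -
      have "i < (m - g) * (k - 1)" using that n by (simp add: mult.commute)
      then have "i div (k - 1) < m - g" by (rule less_mult_imp_div_less)
      then show ?thesis by simp
    qed
    then show ?thesis by (auto simp: F_def)
  qed
  obtain p q p' y l l' where "disjointness_embedding t k (perm_pairs {..<g} n\<^sub>0) p q p' y l l'"
    using emb unfolding embeds_disjointness_def by blast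
  then have "disjointness_embedding t k (perm_pairs {..<m} n) (\<lambda>a. F @ p a) q p' (y @ rev F) (length F + l) l'"
    using lcs
  proof (rule disjointness_embedding_crossing)
    fix x y assume "(x, y) \<in> perm_pairs {..<g} n\<^sub>0"
    then have xy: "set x \<subseteq> {..<g}" "set y \<subseteq> {..<g}" "length x = n\<^sub>0" "mset x = mset y"
      using mset_eq_setD by (auto simp: mem_perm_pairs)
    have "x' < m" if "x' \<in> set F \<union> set x" for x'
      using that setF xy(1) g by fastforce
    moreover have "set F \<inter> {..<g} = {}" using setF by fastforce
    ultimately show "set F \<inter> set y = {} \<and> set (rev F) \<inter> set x = {} \<and> (F @ x, y @ rev F) \<in> perm_pairs {..<m} n"
      using xy len n by (auto simp: mem_perm_pairs)
  qed
  then show ?thesis unfolding embeds_disjointness_def by blast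
qed

text \<open>If \<open>n\<close> is at least \<open>3 * t * (k - 1)\<close>, the ballot instance with
  \<open>h = k - 1\<close> leaves a gap that the other symbols can fill. Otherwise the chain
  instance is used; a common prefix of copies of one further symbol raises its threshold to
  \<open>k\<close>, and at least \<open>3 * t\<close> symbols remain for the filler, which
  suffice.\<close>

lemma embeds_disjointness_perm_pairs_lessThan:
  assumes t: "1 \<le> t" "9 * t + 1 \<le> k" "9 * t + 1 \<le> m" and n: "3 * k \<le> n" "n \<le> (k - 1) * m"
  shows "embeds_disjointness t k (perm_pairs {..<m} n)"
proof (cases "3 * t * (k - 1) \<le> n")
  case True
  have "embeds_disjointness t (k - 1 + 1) (perm_pairs {..<3 * t} (3 * t * (k - 1)))"
    using t by (intro embeds_disjointness_ballot) simp
  then have "embeds_disjointness t k (perm_pairs {..<3 * t} (3 * t * (k - 1)))"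
    using t by simp
  then show ?thesis
  proof (rule embeds_disjointness_filler[OF _ _ True])
    have "(k - 1) * m = (k - 1) * (3 * t + (m - 3 * t))" using t by simp
    also have "\<dots> = 3 * t * (k - 1) + (k - 1) * (m - 3 * t)" by (simp only: distrib_left mult.commute)
    finally show "n \<le> 3 * t * (k - 1) + (k - 1) * (m - 3 * t)" using n by simp
  qed (use t in auto)
next
  case False
  define r where "r = replicate (k - (2 * t + 2)) (6 * t)"
  have k: "2 * t + 2 + length r = k" using t by (simp add: r_def)
  obtain p q p' y l l' where "disjointness_embedding t (2 * t + 2) (perm_pairs {..<6 * t} (6 * t)) p q p' y l l'"
    using embeds_disjointness_chain unfolding embeds_disjointness_def by blast
  then have "disjointness_embedding t (2 * t + 2 + length r) (perm_pairs {..<6 * t + 1} (length r + 6 * t))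
      (\<lambda>a. r @ p a) q p' (r @ y) (length r + l) l'"
    by (rule disjointness_embedding_common_prefix) (auto simp: mem_perm_pairs r_def split: if_splits)
  then have "embeds_disjointness t k (perm_pairs {..<6 * t + 1} (length r + 6 * t))"
    unfolding embeds_disjointness_def k by blast
  then show ?thesis
  proof (rule embeds_disjointness_filler)
    have "3 * t * (k - 1) \<le> (m - (6 * t + 1)) * (k - 1)"
      using t by (intro mult_right_mono) auto
    also have "\<dots> = (k - 1) * (m - (6 * t + 1))" by (rule mult.commute)
    finally show "n \<le> length r + 6 * t + (k - 1) * (m - (6 * t + 1))"
      using False by linarith
  qed (use t n k in auto)
qed

text \<open>Beyond \<open>(k - 1) * m\<close> permutations are useless, but the two strings may be
  padded with different symbols, which contribute nothing in common.\<close>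

lemma embeds_disjointness_string_pairs_lessThan:
  assumes t: "1 \<le> t" "9 * t + 1 \<le> k" "9 * t + 1 \<le> m" and n: "3 * k \<le> n"
  shows "embeds_disjointness t k (string_pairs {..<m} n)"
proof (cases "n \<le> (k - 1) * m")
  case True
  then obtain p q p' y l l' where "disjointness_embedding t k (perm_pairs {..<m} n) p q p' y l l'"
    using embeds_disjointness_perm_pairs_lessThan[OF t n] unfolding embeds_disjointness_def by blast
  then have "disjointness_embedding t k (string_pairs {..<m} n) p q p' y l l'"
    by (simp add: disjointness_embedding_def perm_pairs_def)
  then show ?thesis unfolding embeds_disjointness_def by blast
next
  case False
  have "3 * t * (k - 1) \<le> m * (k - 1)" using t by (intro mult_right_mono) auto
  then have len: "3 * t * (k - 1) \<le> n" using False by (metis mult.commute nle_le order_trans)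
  define F where "F = replicate (n - 3 * t * (k - 1)) (3 * t)"
  define F' where "F' = replicate (n - 3 * t * (k - 1)) (3 * t + 1)"
  have "embeds_disjointness t (k - 1 + 1) (perm_pairs {..<3 * t} (3 * t * (k - 1)))"
    using t by (intro embeds_disjointness_ballot) simp
  then obtain p q p' y l l' where "disjointness_embedding t k (perm_pairs {..<3 * t} (3 * t * (k - 1))) p q p' y l l'"
    using t unfolding embeds_disjointness_def by auto
  moreover have "lcs F F' < k"
  proof -
    obtain z where z: "subseq z F" "subseq z F'" "lcs F F' \<le> length z"
      using le_lcs_iff by blast
    have "set F \<inter> set F' = {}"
      by (auto simp: F_def F'_def)
    moreover have "set z \<subseteq> set F \<inter> set F'"
      using subseq_set_subset[OF z(1)] subseq_set_subset[OF z(2)] by (rule Int_greatest)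
    ultimately show ?thesis using z(3) t by simp
  qed
  ultimately have "disjointness_embedding t k (string_pairs {..<m} n) (\<lambda>a. F @ p a) q p' (y @ F') (length F + l) l'"
  proof (rule disjointness_embedding_crossing)
    fix x y assume "(x, y) \<in> perm_pairs {..<3 * t} (3 * t * (k - 1))"
    then have xy: "set x \<subseteq> {..<3 * t}" "set y \<subseteq> {..<3 * t}" "length x = 3 * t * (k - 1)" "length y = 3 * t * (k - 1)"
      by (auto simp: perm_pairs_def string_pairs_def)
    then have "set F \<inter> set y = {}" "set F' \<inter> set x = {}"
      by (auto simp: F_def F'_def)
    moreover have "(F @ x, y @ F') \<in> string_pairs {..<m} n"
      using xy len t by (auto simp: string_pairs_def F_def F'_def)
    ultimately show "set F \<inter> set y = {} \<and> set F' \<inter> set x = {} \<and> (F @ x, y @ F') \<in> string_pairs {..<m} n"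
      by simp
  qed
  then show ?thesis unfolding embeds_disjointness_def by blast
qed

lemma embeds_disjointness_finite_alphabet:
  fixes \<Sigma> :: "'a set"
  assumes "finite \<Sigma>"
  shows "embeds_disjointness t k (string_pairs {..<card \<Sigma>} n) \<Longrightarrow> embeds_disjointness t k (string_pairs \<Sigma> n)"
    and "embeds_disjointness t k (perm_pairs {..<card \<Sigma>} n) \<Longrightarrow> embeds_disjointness t k (perm_pairs \<Sigma> n)"
proof -
  obtain e where "bij_betw e {..<card \<Sigma>} \<Sigma>"
    using ex_bij_betw_nat_finite[OF assms] by (auto simp: atLeast0LessThan)
  then have e: "inj_on e {..<card \<Sigma>}" "\<And>v. v < card \<Sigma> \<Longrightarrow> e v \<in> \<Sigma>"
    by (auto simp: bij_betw_def)
  show "embeds_disjointness t k (string_pairs \<Sigma> n)" if emb: "embeds_disjointness t k (string_pairs {..<card \<Sigma>} n)"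
  proof -
    obtain p q p' y l l' where "disjointness_embedding t k (string_pairs {..<card \<Sigma>} n) p q p' y l l'"
      using emb unfolding embeds_disjointness_def by blast
    then have "disjointness_embedding t k (string_pairs \<Sigma> n) (map e \<circ> p) (map e \<circ> q) (map e \<circ> p') (map e y) l l'"
      using e(1) by (rule disjointness_embedding_map) (use e(2) in \<open>auto simp: string_pairs_def\<close>)
    then show ?thesis unfolding embeds_disjointness_def by blast
  qed
  show "embeds_disjointness t k (perm_pairs \<Sigma> n)" if emb: "embeds_disjointness t k (perm_pairs {..<card \<Sigma>} n)"
  proof -
    obtain p q p' y l l' where "disjointness_embedding t k (perm_pairs {..<card \<Sigma>} n) p q p' y l l'"
      using emb unfolding embeds_disjointness_def by blast
    then have "disjointness_embedding t k (perm_pairs \<Sigma> n) (map e \<circ> p) (map e \<circ> q) (map e \<circ> p') (map e y) l l'"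
      using e(1) by (rule disjointness_embedding_map) (use e(2) in \<open>auto simp: perm_pairs_def string_pairs_def\<close>)
    then show ?thesis unfolding embeds_disjointness_def by blast
  qed
qed

text \<open>Since \<open>\<mu> \<le> 9 * t + 9 \<le> 18 * t\<close>, the constant is
  \<open>31104 = 18 * 1728\<close>.\<close>

lemma space_ge_of_embeds_disjointness:
  fixes D :: "'a stream_alg pmf"
  assumes "\<mu> \<ge> 10" "embeds_disjointness ((\<mu> - 1) div 9) k I" "uses_space s D" "decides_lcs_ge R k I D" "R \<ge> 1"
  shows "1 / 31104 * (real \<mu> / real R) \<le> real s"
proof -
  define t where "t = (\<mu> - 1) div 9"
  obtain p q p' y l l' where "disjointness_embedding t k I p q p' y l l'"
    using assms(2) unfolding embeds_disjointness_def t_def by blast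
  then have "real t \<le> 1728 * (real R * real s)"
    using assms(3,4) by (rule space_ge_of_disjointness_embedding)
  moreover have "1 \<le> t" "\<mu> \<le> 9 * t + 9" unfolding t_def using assms(1) by linarith+
  ultimately have "real \<mu> \<le> 31104 * (real R * real s)" by linarith
  then show ?thesis using assms(5) by (simp add: field_simps)
qed

theorem theorem1p3:
  shows "\<exists>c>1::real. \<exists>\<delta>>0::real. \<exists>m\<^sub>0::nat.
    \<forall>(k::nat) (n::nat) (R::nat) (s::nat) (\<Sigma>::nat set) (D::nat stream_alg pmf).
      c * real k \<le> real n \<longrightarrow> R \<ge> 1 \<longrightarrow> finite \<Sigma> \<longrightarrow> min k (card \<Sigma>) \<ge> m\<^sub>0 \<longrightarrow> uses_space s D \<longrightarrow>
      (decides_lcs_ge R k (string_pairs \<Sigma> n) D \<longrightarrow>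
         real s \<ge> \<delta> * (real (min k (card \<Sigma>)) / real R)) \<and>
      (card \<Sigma> \<ge> n \<or> card \<Sigma> \<le> k \<and> n \<le> (k - 1) * card \<Sigma> \<longrightarrow>
         decides_lcs_ge R k (perm_pairs \<Sigma> n) D \<longrightarrow>
         real s \<ge> \<delta> * (real (min k (card \<Sigma>)) / real R))"
proof (rule exI[of _ "3::real"], intro conjI, simp, rule exI[of _ "1 / 31104::real"], intro conjI, simp,
    rule exI[of _ "10::nat"], intro allI impI conjI)
  fix k n R s :: nat and \<Sigma> :: "nat set" and D :: "nat stream_alg pmf"
  assume "3 * real k \<le> real n" and R: "R \<ge> 1" and fin: "finite \<Sigma>" and \<mu>: "min k (card \<Sigma>) \<ge> 10"
    and space: "uses_space s D"
  then have n: "3 * k \<le> n" by simp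
  define t where "t = (min k (card \<Sigma>) - 1) div 9"
  have t: "1 \<le> t" "9 * t + 1 \<le> k" "9 * t + 1 \<le> card \<Sigma>"
    using \<mu> unfolding t_def by linarith+
  show "1 / 31104 * (real (min k (card \<Sigma>)) / real R) \<le> real s"
    if "decides_lcs_ge R k (string_pairs \<Sigma> n) D"
    using embeds_disjointness_finite_alphabet(1)[OF fin embeds_disjointness_string_pairs_lessThan[OF t n]]
    unfolding t_def by (rule space_ge_of_embeds_disjointness[OF \<mu> _ space that R])
  assume "card \<Sigma> \<ge> n \<or> card \<Sigma> \<le> k \<and> n \<le> (k - 1) * card \<Sigma>"
  \<comment> \<open>Puts the case \<open>n \<le> card \<Sigma>\<close> under the same length bound
    as the other case.\<close>
  moreover have "card \<Sigma> \<le> (k - 1) * card \<Sigma>" using \<mu> by (cases "k - 1") auto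
  ultimately have "n \<le> (k - 1) * card \<Sigma>" by linarith
  then have "embeds_disjointness t k (perm_pairs \<Sigma> n)"
    using embeds_disjointness_finite_alphabet(2)[OF fin embeds_disjointness_perm_pairs_lessThan[OF t n]] by simp
  then show "1 / 31104 * (real (min k (card \<Sigma>)) / real R) \<le> real s"
    if "decides_lcs_ge R k (perm_pairs \<Sigma> n) D"
    unfolding t_def by (rule space_ge_of_embeds_disjointness[OF \<mu> _ space that R])
qed

end
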